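(* Let $q$ be a prime power, let $n,k>0$ be integers, and let $\varepsilon,\nu\in(0,1)$. Then an $(\varepsilon,\nu)$-Kakeya set $E\subseteq \mathbb{F}_q[\![t]\!]^n$ cannot be covered by fewer than \[\binom{\big\lfloor\tfrac{\nu\varepsilon}{kn}q^{k-1}\big\rfloor+n}{n}\] closed balls of radius $q^{-k}$.
   Context: $K=\mathbb{F}_q(\!(t)\!)$ is the field of formal Laurent series over $\mathbb{F}_q$, $A=\mathbb{F}_q[\![t]\!]$. For nonzero $a\in K$, $v_t(a)$ is the least $m$ with nonzero coefficient of $t^m$, $|a|=q^{-v_t(a)}$, $|0|=0$; $K^n$ carries the supremum norm $|(a_1,\dots,a_n)|=\max_j|a_j|$, and balls are taken with respect to this norm. Measures on $A$ and $A^n$ are Haar measures normalized so that $A$ (resp. $A^n$) has measure $1$. A vector $w\in A^n$ is primitive if $|w|=1$; $S^{n-1}(A)$ denotes the set of primitive vectors of $A^n$. An $(\varepsilon,\nu)$-Kakeya set is a set $E\subseteq K^n$ for which there is a measurable set $\Omega\subseteq S^{n-1}(A)$ of measure $\geq\nu$ such that for every $w\in\Omega$ there exist $b_w\in K^n$ and a measurable $J_w\subseteq A$ of measure $\geq\varepsilon$ with $b_w+wJ_w=\{b_w+xw:x\in J_w\}\subseteq E$. *)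

theory Defs
  imports
    "HOL-Probability.Probability"
    "HOL-Computational_Algebra.Formal_Laurent_Series"
begin

unbundle no Formal_Power_Series.fps_syntax

section \<open>Laurent series over a finite field\<close>

text \<open>
  A finite field is a type of class \<open>{field, finite}\<close>, and \<open>q\<close> is its cardinality. The field
  \<open>K\<close> of formal Laurent series is \<^typ>\<open>'a fls\<close> and \<open>K^n\<close> is \<^typ>\<open>'a fls ^ 'n\<close>. The library metric
  on \<^typ>\<open>'a fls\<close> uses base 2 and the one on vectors is Euclidean; they induce the same topology
  (hence the same Borel sets) as the \<open>q\<close>-adic supremum norm, but not the same balls, so the norm
  is introduced separately here.
\<close>

definition fls_abs :: "'a::{field,finite} fls \<Rightarrow> real" where
  "fls_abs a = (if a = 0 then 0 else real CARD('a) powi (- fls_subdegree a))"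

definition sup_norm :: "'a::{field,finite} fls ^ 'n \<Rightarrow> real" where
  "sup_norm x = Max (range (\<lambda>j. fls_abs (x $ j)))"

definition sup_cball :: "'a::{field,finite} fls ^ 'n \<Rightarrow> real \<Rightarrow> ('a fls ^ 'n) set" where
  "sup_cball c r = {x. sup_norm (x - c) \<le> r}"

definition power_series :: "'a::{field,finite} fls set" where
  "power_series = range fps_to_fls"

definition power_series_vecs :: "('a::{field,finite} fls ^ 'n) set" where
  "power_series_vecs = {x. \<forall>j. x $ j \<in> power_series}"

definition primitive_vecs :: "('a::{field,finite} fls ^ 'n) set" where
  "primitive_vecs = {w \<in> power_series_vecs. sup_norm w = 1}"


section \<open>Haar measure\<close>

text \<open>
  \<open>G\<close> is a compact subgroup of a topological abelian group; the measure lives on the Borel sets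
  of \<open>G\<close>. Regularity is not demanded, since it is automatic in the compact metrizable groups
  considered here.
\<close>

definition normalized_haar ::
    "'g::{topological_space,ab_group_add} set \<Rightarrow> 'g measure \<Rightarrow> bool" where
  "normalized_haar G M \<longleftrightarrow>
     sets M = sets (restrict_space borel G) \<and>
     emeasure M G = 1 \<and>
     (\<forall>g\<in>G. \<forall>X\<in>sets M. emeasure M ((\<lambda>x. g + x) ` X) = emeasure M X)"

definition haar :: "'g::{topological_space,ab_group_add} set \<Rightarrow> 'g measure" where
  "haar G = (SOME M. normalized_haar G M)"


section \<open>Kakeya sets\<close>

definition kakeya_set :: "real \<Rightarrow> real \<Rightarrow> ('a::{field,finite} fls ^ 'n) set \<Rightarrow> bool" where
  "kakeya_set \<epsilon> \<nu> E \<longleftrightarrow>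
     (\<exists>\<Omega> \<in> sets (haar (power_series_vecs :: ('a fls ^ 'n) set)).
        \<Omega> \<subseteq> primitive_vecs \<and>
        measure (haar power_series_vecs) \<Omega> \<ge> \<nu> \<and>
        (\<forall>w\<in>\<Omega>. \<exists>b. \<exists>J \<in> sets (haar (power_series :: 'a fls set)).
           measure (haar power_series) J \<ge> \<epsilon> \<and>
           {b + x *s w | x. x \<in> J} \<subseteq> E))"


section \<open>Existence of the Haar measures\<close>

text \<open>
  The choice in the definition of \<^const>\<open>haar\<close> is justified for the two groups that are used: the
  coefficientwise product of uniform measures is a normalized Haar measure.
\<close>

lemma dist_fls_diff_right: "dist (x - g) (y - g) = dist x (y :: 'a::ab_group_add fls)"
  by (simp add: dist_fls_def)

lemma dist_fls_vec_diff_right: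
  "dist (x - g) (y - g) = dist x (y :: 'a::ab_group_add fls ^ 'n)"
  by (simp add: dist_vec_def dist_fls_diff_right)

lemma dist_fls_less:
  fixes a b :: "'a::ab_group_add fls"
  assumes "\<And>j. j < int m \<Longrightarrow> fls_nth a j = fls_nth b j"
  shows "dist a b \<le> inverse (2 ^ m)"
proof (cases "a = b")
  case False
  then have "fls_nth (a - b) (fls_subdegree (a - b)) \<noteq> 0"
    by (intro nth_fls_subdegree_nonzero) simp
  then have *: "fls_subdegree (a - b) \<ge> int m"
    using assms by (metis eq_iff_diff_eq_0 fls_minus_nth not_less)
  then have "m \<le> nat (fls_subdegree (a - b))" by linarith
  then have "(2::real) ^ m \<le> 2 ^ nat (fls_subdegree (a - b))" by (intro power_increasing) auto
  then show ?thesis using * False by (simp add: dist_fls_def)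
qed simp

definition of_coeffs :: "('n \<times> nat \<Rightarrow> 'a::{field,finite}) \<Rightarrow> 'a fls ^ 'n" where
  "of_coeffs s = (\<chi> i. fps_to_fls (Abs_fps (\<lambda>m. s (i, m))))"

lemma of_coeffs_diff: "of_coeffs (\<lambda>i. s i - c i) = of_coeffs s - of_coeffs c"
proof -
  have "Abs_fps (\<lambda>m. s (i, m) - c (i, m)) =
      Abs_fps (\<lambda>m. s (i, m)) - Abs_fps (\<lambda>m. c (i, m))" for i
    by (simp add: fps_eq_iff)
  then show ?thesis by (simp add: of_coeffs_def vec_eq_iff)
qed

lemma range_of_coeffs:
  "range of_coeffs = (power_series_vecs :: ('a::{field,finite} fls ^ 'n) set)"
proof
  show "range of_coeffs \<subseteq> (power_series_vecs :: ('a fls ^ 'n) set)"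
    by (auto simp: of_coeffs_def power_series_vecs_def power_series_def)
  show "(power_series_vecs :: ('a fls ^ 'n) set) \<subseteq> range of_coeffs"
  proof
    fix x :: "'a fls ^ 'n" assume "x \<in> power_series_vecs"
    then have "\<forall>i. \<exists>f. x $ i = fps_to_fls f"
      by (auto simp: power_series_vecs_def power_series_def)
    then obtain f where "\<And>i. x $ i = fps_to_fls (f i)" by metis
    then have "x = of_coeffs (\<lambda>(i, m). fps_nth (f i) m)"
      by (simp add: of_coeffs_def vec_eq_iff fps_eq_iff)
    then show "x \<in> range of_coeffs" by blast
  qed
qed

definition coeff_measure :: "('n \<times> nat \<Rightarrow> 'a::finite) measure" where
  "coeff_measure = PiM UNIV (\<lambda>_. uniform_count_measure UNIV)"

lemma space_coeff_measure [simp]: "space coeff_measure = UNIV"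
  by (auto simp: coeff_measure_def space_PiM space_uniform_count_measure)

lemma prob_space_uniform: "prob_space (uniform_count_measure (UNIV :: 'a::finite set))"
  by (rule prob_space_uniform_count_measure) auto

lemma product_prob_space_uniform:
  "product_prob_space (\<lambda>_. uniform_count_measure (UNIV :: 'a::finite set))"
proof -
  interpret prob_space "uniform_count_measure (UNIV :: 'a set)" by (rule prob_space_uniform)
  show ?thesis by unfold_locales
qed

definition cylinder :: "nat \<Rightarrow> ('n \<times> nat \<Rightarrow> 'a) \<Rightarrow> ('n \<times> nat \<Rightarrow> 'a) set" where
  "cylinder m s = {s'. \<forall>p \<in> UNIV \<times> {..<m}. s' p = s p}"

lemma cylinder_measurable: "cylinder m (s :: 'n::finite \<times> nat \<Rightarrow> 'a::finite) \<in> sets coeff_measure"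
proof -
  have "cylinder m s = prod_emb UNIV (\<lambda>_. uniform_count_measure UNIV)
      (UNIV \<times> {..<m}) (\<Pi>\<^sub>E p \<in> UNIV \<times> {..<m}. {s p})"
    by (auto simp: cylinder_def prod_emb_def space_uniform_count_measure PiE_def Pi_def)
  also have "\<dots> \<in> sets coeff_measure"
    unfolding coeff_measure_def
    by (rule sets_PiM_I) (auto simp: sets_uniform_count_measure)
  finally show ?thesis .
qed

lemma finite_cylinders: "finite (range (cylinder m :: ('n::finite \<times> nat \<Rightarrow> 'a::finite) \<Rightarrow> _))"
proof -
  let ?I = "UNIV \<times> {..<m} :: ('n \<times> nat) set"
  have "cylinder m s = cylinder m (restrict s ?I)" for s :: "'n \<times> nat \<Rightarrow> 'a"
    by (auto simp: cylinder_def)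
  moreover have "restrict s ?I \<in> PiE ?I (\<lambda>_. UNIV)" for s :: "'n \<times> nat \<Rightarrow> 'a"
    by auto
  ultimately have "range (cylinder m :: ('n \<times> nat \<Rightarrow> 'a) \<Rightarrow> _) \<subseteq> cylinder m ` (PiE ?I (\<lambda>_. UNIV))"
    by blast
  moreover have "finite (PiE ?I (\<lambda>_. UNIV :: 'a set))" by (intro finite_PiE) auto
  ultimately show ?thesis by (meson finite_imageI finite_subset)
qed

lemma cylinder_in_open:
  fixes s :: "'n::finite \<times> nat \<Rightarrow> 'a::{field,finite}"
  assumes "open U" "of_coeffs s \<in> U"
  shows "\<exists>m. of_coeffs ` cylinder m s \<subseteq> U"
proof -
  obtain A where A: "\<And>i. open (A i)" "\<And>i. of_coeffs s $ i \<in> A i"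
      "\<And>y. (\<forall>i. y $ i \<in> A i) \<Longrightarrow> y \<in> U"
    using assms unfolding open_vec_def by metis
  have "\<forall>i. \<exists>e>0. \<forall>y. dist y (of_coeffs s $ i) < e \<longrightarrow> y \<in> A i"
    using A unfolding open_dist by metis
  then obtain e where e: "\<And>i. e i > 0" "\<And>i y. dist y (of_coeffs s $ i) < e i \<Longrightarrow> y \<in> A i"
    by metis
  define d where "d = Min (range e)"
  have d: "d > 0" "\<And>i. d \<le> e i" using e by (auto simp: d_def)
  obtain m where m: "inverse (2 ^ m) < d"
    using d(1) reals_power_lt_ex[of d 2] by (auto simp: inverse_eq_divide power_one_over)
  have "of_coeffs s' \<in> U" if s': "s' \<in> cylinder m s" for s'
  proof (intro A(3) allI e(2))
    fix i
    have "fls_nth (of_coeffs s' $ i) j = fls_nth (of_coeffs s $ i) j" if "j < int m" for j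
      using s' that by (auto simp: of_coeffs_def cylinder_def)
    then have "dist (of_coeffs s' $ i) (of_coeffs s $ i) \<le> inverse (2 ^ m)"
      by (rule dist_fls_less)
    then show "dist (of_coeffs s' $ i) (of_coeffs s $ i) < e i"
      using m d(2)[of i] by linarith
  qed
  then show ?thesis by blast
qed

lemma of_coeffs_borel:
  "(of_coeffs :: ('n::finite \<times> nat \<Rightarrow> 'a::{field,finite}) \<Rightarrow> _) \<in> borel_measurable coeff_measure"
proof (rule borel_measurableI)
  fix U :: "('a fls ^ 'n) set" assume U: "open U"
  define \<C> where "\<C> = {C \<in> (\<Union>m. range (cylinder m)). of_coeffs ` C \<subseteq> U}"
  have "countable (\<Union>m. range (cylinder m :: ('n \<times> nat \<Rightarrow> 'a) \<Rightarrow> _))"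
    by (rule countable_UN) (simp_all add: countable_finite finite_cylinders)
  then have "countable \<C>" by (rule countable_subset[rotated]) (auto simp: \<C>_def)
  moreover have "\<C> \<subseteq> sets coeff_measure" by (auto simp: \<C>_def intro: cylinder_measurable)
  ultimately have "\<Union>\<C> \<in> sets coeff_measure" by (rule sets.countable_Union)
  moreover have "of_coeffs -` U = \<Union>\<C>"
  proof
    show "of_coeffs -` U \<subseteq> \<Union>\<C>"
    proof
      fix s :: "'n \<times> nat \<Rightarrow> 'a" assume "s \<in> of_coeffs -` U"
      then obtain m where "of_coeffs ` cylinder m s \<subseteq> U" using cylinder_in_open[OF U] by blast
      then have "cylinder m s \<in> \<C>" by (auto simp: \<C>_def)
      moreover have "s \<in> cylinder m s" by (simp add: cylinder_def)
      ultimately show "s \<in> \<Union>\<C>" by blast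
    qed
  qed (auto simp: \<C>_def)
  ultimately show "of_coeffs -` U \<inter> space (coeff_measure :: ('n \<times> nat \<Rightarrow> 'a) measure) \<in> sets coeff_measure"
    by simp
qed

lemma coeff_measure_translate:
  fixes c :: "'n \<times> nat \<Rightarrow> 'a::{field,finite}"
  defines "T \<equiv> \<lambda>s i. s i - c i"
  shows "T \<in> measurable coeff_measure coeff_measure"
    and "distr coeff_measure coeff_measure T = coeff_measure"
proof -
  let ?u = "\<lambda>_ :: 'n \<times> nat. uniform_count_measure (UNIV :: 'a set)"
  interpret product_prob_space ?u UNIV by (rule product_prob_space_uniform)
  show T: "T \<in> measurable coeff_measure coeff_measure"
    unfolding coeff_measure_def T_def
  proof (rule measurable_PiM_single')
    fix i :: "'n \<times> nat"
    have "(\<lambda>x. x - c i) \<in> measurable (?u i) (?u i)"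
      by (auto simp: measurable_def space_uniform_count_measure sets_uniform_count_measure)
    then show "(\<lambda>s. s i - c i) \<in> measurable (PiM UNIV ?u) (?u i)"
      by (rule measurable_compose[rotated]) simp
  qed (auto simp: space_uniform_count_measure)
  have "distr coeff_measure coeff_measure T = PiM UNIV ?u"
  proof (rule PiM_eq)
    fix J :: "('n \<times> nat) set" and F :: "'n \<times> nat \<Rightarrow> 'a set"
    assume J: "finite J"
    let ?E = "\<lambda>F. prod_emb UNIV ?u J (PiE J F)"
    let ?F = "\<lambda>i. (\<lambda>x. x + c i) ` F i"
    have vim: "T -` ?E F = ?E ?F"
    proof -
      have 1: "s \<in> ?E F \<longleftrightarrow> (\<forall>j\<in>J. s j \<in> F j)" for s F
        by (auto simp: prod_emb_def space_uniform_count_measure PiE_def Pi_def)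
      have 2: "T s j \<in> F j \<longleftrightarrow> s j \<in> ?F j" for s j
        by (force simp: T_def image_iff algebra_simps)
      show ?thesis unfolding set_eq_iff vimage_eq 1 2 by simp
    qed
    have "emeasure (distr coeff_measure coeff_measure T) (?E F) =
        emeasure coeff_measure (T -` ?E F \<inter> space coeff_measure)"
      by (rule emeasure_distr[OF T])
         (use J in \<open>auto simp: coeff_measure_def sets_uniform_count_measure intro!: sets_PiM_I\<close>)
    also have "\<dots> = emeasure (PiM UNIV ?u) (?E ?F)"
      by (simp add: vim) (simp add: coeff_measure_def)
    also have "\<dots> = (\<Prod>j\<in>J. emeasure (?u j) (?F j))"
      by (rule emeasure_PiM_emb) (use J in \<open>auto simp: sets_uniform_count_measure\<close>)
    also have "\<dots> = (\<Prod>j\<in>J. emeasure (?u j) (F j))"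
      by (intro prod.cong refl) (simp add: emeasure_uniform_count_measure card_image)
    finally show "emeasure (distr coeff_measure coeff_measure T) (?E F) =
        (\<Prod>j\<in>J. emeasure (?u j) (F j))" .
  qed (simp add: coeff_measure_def)
  then show "distr coeff_measure coeff_measure T = coeff_measure"
    by (simp add: coeff_measure_def)
qed

lemma translate_sets_borel:
  fixes G :: "'g::{metric_space,ab_group_add} set"
  assumes dist: "\<And>x y g :: 'g. dist (x - g) (y - g) = dist x y"
    and G: "\<And>x. g + x \<in> G \<longleftrightarrow> x \<in> G"
    and X: "X \<in> sets (restrict_space borel G)"
  shows "(\<lambda>x. g + x) ` X \<in> sets (restrict_space borel G)"
proof -
  obtain B where B: "B \<in> sets borel" "X = G \<inter> B" using X by (auto simp: sets_restrict_space)
  have "continuous_on UNIV (\<lambda>x. x - g)"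
    unfolding continuous_on_iff dist by auto
  then have "(\<lambda>x. x - g) \<in> borel_measurable borel" by (rule borel_measurable_continuous_onI)
  from measurable_sets[OF this B(1)] have m: "(\<lambda>x. x - g) -` B \<in> sets borel" by simp
  have "(\<lambda>x. g + x) ` X = G \<inter> (\<lambda>x. x - g) -` B"
  proof (intro set_eqI iffI)
    fix y assume y: "y \<in> G \<inter> (\<lambda>x. x - g) -` B"
    then have "y = g + (y - g)" "y - g \<in> X" using G[of "y - g"] B by auto
    then show "y \<in> (\<lambda>x. g + x) ` X" by blast
  qed (use B G in auto)
  with m show ?thesis by (auto simp: sets_restrict_space)
qed

lemma power_series_add: "g \<in> power_series \<Longrightarrow> g + x \<in> power_series \<longleftrightarrow> x \<in> power_series"
proof -
  assume "g \<in> power_series"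
  then obtain f where f: "g = fps_to_fls f" by (auto simp: power_series_def)
  show ?thesis
  proof
    assume "g + x \<in> power_series"
    then obtain h where "g + x = fps_to_fls h" by (auto simp: power_series_def)
    then have "x = fps_to_fls (h - f)" by (simp add: f algebra_simps)
    then show "x \<in> power_series" unfolding power_series_def by blast
  next
    assume "x \<in> power_series"
    then obtain h where "x = fps_to_fls h" by (auto simp: power_series_def)
    then have "g + x = fps_to_fls (f + h)" by (simp add: f)
    then show "g + x \<in> power_series" unfolding power_series_def by blast
  qed
qed

lemma normalized_haar_vecs_exists:
  "\<exists>M. normalized_haar (power_series_vecs :: ('a::{field,finite} fls ^ 'n) set) M"
proof -
  let ?P = "coeff_measure :: ('n \<times> nat \<Rightarrow> 'a) measure"
  let ?G = "power_series_vecs :: ('a fls ^ 'n) set"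
  let ?R = "restrict_space borel ?G"
  have f: "of_coeffs \<in> measurable ?P ?R"
    by (rule measurable_restrict_space2) (use range_of_coeffs of_coeffs_borel in auto)
  define M where "M = distr ?P ?R of_coeffs"
  have em: "emeasure M X = emeasure ?P (of_coeffs -` X)" if "X \<in> sets ?R" for X
    using emeasure_distr[OF f that] by (simp add: M_def)
  have "normalized_haar ?G M"
    unfolding normalized_haar_def
  proof (intro conjI ballI)
    show sM: "sets M = sets ?R" by (simp add: M_def)
    have "?G \<in> sets ?R" by (auto simp: sets_restrict_space)
    moreover have "of_coeffs -` ?G = (UNIV :: ('n \<times> nat \<Rightarrow> 'a) set)" using range_of_coeffs by auto
    moreover have "emeasure ?P UNIV = 1"
      using prob_space.emeasure_space_1[OF prob_space_PiM[OF prob_space_uniform]]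
      by (metis coeff_measure_def space_coeff_measure)
    ultimately show "emeasure M ?G = 1" by (simp add: em)
    fix g X assume g: "g \<in> ?G" and "X \<in> sets M"
    then have X: "X \<in> sets ?R" by (simp add: sM)
    obtain c where c: "g = of_coeffs c" using g range_of_coeffs by blast
    have gX: "(\<lambda>x. g + x) ` X \<in> sets ?R"
      using dist_fls_vec_diff_right _ X
    proof (rule translate_sets_borel)
      show "g + x \<in> ?G \<longleftrightarrow> x \<in> ?G" for x
        using g power_series_add by (auto simp: power_series_vecs_def)
    qed
    have fX: "of_coeffs -` X \<in> sets ?P" using measurable_sets[OF f X] by simp
    let ?T = "\<lambda>s i. s i - c i"
    have "of_coeffs -` ((\<lambda>x. g + x) ` X) = ?T -` (of_coeffs -` X)"
      by (auto simp: of_coeffs_diff c image_iff) (metis add_diff_cancel_left' diff_add_cancel add.commute)+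
    then have "emeasure M ((\<lambda>x. g + x) ` X) = emeasure ?P (?T -` (of_coeffs -` X))"
      by (simp add: em[OF gX])
    also have "\<dots> = emeasure (distr ?P ?P ?T) (of_coeffs -` X)"
      using emeasure_distr[OF coeff_measure_translate(1) fX, of c] by simp
    also have "\<dots> = emeasure M X" by (simp add: coeff_measure_translate(2) em[OF X])
    finally show "emeasure M ((\<lambda>x. g + x) ` X) = emeasure M X" .
  qed
  then show ?thesis by blast
qed

lemma normalized_haar_power_series_exists:
  "\<exists>M. normalized_haar (power_series :: 'a::{field,finite} fls set) M"
proof -
  let ?G = "power_series :: 'a fls set"
  let ?V = "power_series_vecs :: ('a fls ^ 1) set"
  let ?R = "restrict_space borel ?G"
  obtain N where N: "normalized_haar ?V N" using normalized_haar_vecs_exists by blast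
  have sN: "sets N = sets (restrict_space borel ?V)" using N by (simp add: normalized_haar_def)
  have spN: "space N = ?V" using sets_eq_imp_space_eq[OF sN] by (simp add: space_restrict_space)
  define \<pi> where "\<pi> = (\<lambda>x :: 'a fls ^ 1. x $ 1)"
  have "\<pi> \<in> borel_measurable borel"
    unfolding \<pi>_def by (intro borel_measurable_continuous_onI continuous_on_component continuous_on_id)
  then have "\<pi> \<in> measurable (restrict_space borel ?V) ?R"
    by (intro measurable_restrict_space2 measurable_restrict_space1)
       (auto simp: space_restrict_space power_series_vecs_def \<pi>_def)
  then have \<pi>: "\<pi> \<in> measurable N ?R" using measurable_cong_sets[OF sN refl] by blast
  define M where "M = distr N ?R \<pi>"
  have em: "emeasure M X = emeasure N (\<pi> -` X \<inter> ?V)" if "X \<in> sets ?R" for X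
    using emeasure_distr[OF \<pi> that] by (simp add: M_def spN)
  have "normalized_haar ?G M"
    unfolding normalized_haar_def
  proof (intro conjI ballI)
    show sM: "sets M = sets ?R" by (simp add: M_def)
    have "?G \<in> sets ?R" by (auto simp: sets_restrict_space)
    moreover have "\<pi> -` ?G \<inter> ?V = ?V" by (auto simp: power_series_vecs_def \<pi>_def)
    ultimately show "emeasure M ?G = 1" using N by (simp add: em normalized_haar_def)
    fix g X assume g: "g \<in> ?G" and "X \<in> sets M"
    then have X: "X \<in> sets ?R" by (simp add: sM)
    have gX: "(\<lambda>x. g + x) ` X \<in> sets ?R"
      using dist_fls_diff_right power_series_add[OF g] X by (rule translate_sets_borel)
    let ?g = "vec g :: 'a fls ^ 1"
    have XG: "X \<subseteq> ?G" using X by (auto simp: sets_restrict_space)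
    have gV: "?g \<in> ?V" using g by (simp add: power_series_vecs_def)
    have "\<pi> -` ((\<lambda>x. g + x) ` X) \<inter> ?V = (\<lambda>x. ?g + x) ` (\<pi> -` X \<inter> ?V)"
    proof (intro set_eqI iffI)
      fix y assume "y \<in> \<pi> -` ((\<lambda>x. g + x) ` X) \<inter> ?V"
      then obtain x where x: "x \<in> X" "y $ 1 = g + x" by (auto simp: \<pi>_def)
      then have "y = ?g + vec x" by (simp add: vec_eq_iff forall_1)
      moreover have "vec x \<in> \<pi> -` X \<inter> ?V"
        using x XG by (auto simp: \<pi>_def power_series_vecs_def)
      ultimately show "y \<in> (\<lambda>x. ?g + x) ` (\<pi> -` X \<inter> ?V)" by blast
    next
      fix y assume "y \<in> (\<lambda>x. ?g + x) ` (\<pi> -` X \<inter> ?V)"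
      then obtain x where x: "y = ?g + x" "x $ 1 \<in> X" by (auto simp: \<pi>_def)
      then have y1: "y $ 1 = g + x $ 1" by simp
      then have "y $ 1 \<in> ?G" using power_series_add[OF g, of "x $ 1"] x XG by auto
      then have "y \<in> ?V" by (simp add: power_series_vecs_def forall_1)
      then show "y \<in> \<pi> -` ((\<lambda>x. g + x) ` X) \<inter> ?V"
        using y1 x(2) by (simp add: \<pi>_def)
    qed
    moreover have "\<pi> -` X \<inter> ?V \<in> sets N" using measurable_sets[OF \<pi> X] by (simp add: spN)
    ultimately show "emeasure M ((\<lambda>x. g + x) ` X) = emeasure M X"
      using N gV by (simp add: em[OF gX] em[OF X] normalized_haar_def)
  qed
  then show ?thesis by blast
qed

lemma normalized_haar_haar_vecs: "normalized_haar power_series_vecs (haar power_series_vecs)"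
  unfolding haar_def using normalized_haar_vecs_exists by (rule someI_ex)

lemma normalized_haar_haar: "normalized_haar power_series (haar power_series)"
  unfolding haar_def using normalized_haar_power_series_exists by (rule someI_ex)

end

theory Submission
  imports Defs
begin

text \<open>
  Let \<open>T y = y^q + s y\<close> be a Carlitz module over \<open>F\<^sub>q[[X]]\<close> whose parameter \<open>s\<close> is chosen such that
  \<open>X\<close> is a primitive \<open>t^k\<close>-torsion point. The map \<open>\<phi> (\<Sum> x\<^sub>i t^i) = \<Sum> x\<^sub>i T^i X\<close> embeds
  \<open>F\<^sub>q[t]/t^k\<close> into \<open>X F\<^sub>q[[X]]\<close> and turns multiplication by \<open>w\<close> into the polynomial
  \<open>C\<^sub>w = \<Sum> w\<^sub>i T^i\<close>, which reduces to \<open>\<Sum> w\<^sub>i z^(q^i)\<close> modulo \<open>X\<close>.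

  If \<open>E\<close> is covered by few balls, linear algebra gives a polynomial \<open>f\<close> of degree at most \<open>d\<close> over
  \<open>F\<^sub>q[[X]]\<close>, nonzero modulo \<open>X\<close>, that vanishes on \<open>\<phi>(E)\<close>. On a line with direction \<open>w\<close> the
  polynomial \<open>f (\<phi>(b) + C\<^sub>w(z))\<close> has at least \<open>\<epsilon> q^k\<close> roots \<open>\<phi>(x)\<close>, all of them divisible by \<open>X\<close>, so
  modulo \<open>X\<close> it vanishes at \<open>z = 0\<close> to order at least \<open>\<epsilon> q^k\<close>. For a nonzero polynomial of degree
  at most \<open>d\<close> over \<open>F\<^sub>q\<close>, however, the order at \<open>z = 0\<close> after substituting \<open>\<Sum> w\<^sub>i z^(q^i)\<close>, truncated at
  \<open>q^k\<close>, is on average over all \<open>w\<close> at most \<open>d (k + 1)\<close>.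
\<close>

subsection \<open>The Frobenius of a finite field\<close>

text \<open>Multiplication by a nonzero \<open>x\<close> permutes the nonzero elements, so their
  product absorbs the factor \<open>x ^ (CARD('a) - 1)\<close>.\<close>

lemma finite_field_power_card:
  fixes x :: "'a::{field,finite}"
  shows "x ^ CARD('a) = x"
proof (cases "x = 0")
  case False
  have "(\<Prod>y\<in>UNIV-{0}. x * y) = (\<Prod>y\<in>UNIV-{0}. y)"
    by (rule prod.reindex_bij_witness[of _ "\<lambda>y. y / x" "\<lambda>y. x * y"]) (use False in auto)
  then have "x ^ (CARD('a) - 1) * \<Prod>(UNIV-{0::'a}) = 1 * \<Prod>(UNIV-{0::'a})"
    by (simp add: prod.distrib)
  moreover have "\<Prod>(UNIV-{0::'a}) \<noteq> 0" by simp
  ultimately have "x ^ (CARD('a) - 1) = 1" by (metis mult_cancel_right)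
  then have "x * x ^ (CARD('a) - 1) = x" by simp
  then show ?thesis by (metis power_minus_mult zero_less_card_finite mult.commute)
qed simp

lemma card_field_ge_2: "CARD('a::{field,finite}) \<ge> 2"
proof -
  have "card {0, 1 :: 'a} \<le> CARD('a)" by (rule card_mono) auto
  then show ?thesis by simp
qed

text \<open>The polynomial \<open>(1 + X)^q - X^q - 1\<close> has degree below \<open>q\<close> and \<open>q\<close> roots.\<close>

lemma of_nat_card_choose_eq_0:
  assumes "0 < i" "i < CARD('a::{field,finite})"
  shows "of_nat (CARD('a) choose i) = (0 :: 'a)"
proof -
  define P :: "'a poly" where "P = [:1, 1:] ^ CARD('a) - monom 1 (CARD('a)) - 1"
  have co: "coeff P j = of_nat (CARD('a) choose j) - (if j = CARD('a) then 1 else 0) - (if j = 0 then 1 else 0)" if "j \<le> CARD('a)" for j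
    using that by (auto simp: P_def coeff_linear_poly_power)
  have "coeff P j = 0" if "j \<ge> CARD('a)" for j
  proof (cases "j = CARD('a)")
    case False
    with that have "degree ([:1, 1 :: 'a:] ^ CARD('a)) < j" by (simp add: degree_linear_power)
    then show ?thesis using that False by (simp add: P_def coeff_eq_0)
  qed (simp add: co)
  then have deg: "degree P < CARD('a)"
    by (intro degree_lessI) auto
  have root: "poly P x = 0" for x
    using finite_field_power_card[of x] finite_field_power_card[of "1 + x"]
    by (simp add: P_def poly_monom add.commute)
  have "P = 0"
  proof (rule ccontr)
    assume "P \<noteq> 0"
    then have "card {x. poly P x = 0} \<le> degree P" by (rule card_poly_roots_bound)
    with root deg show False by simp
  qed
  then have "coeff P i = 0" by simp
  with assms show ?thesis by (simp add: co)
qed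

text \<open>Together with c^q = c for constants this makes \<open>carlitz s\<close> linear over the
  finite field.\<close>

lemma fps_add_power_card:
  fixes x y :: "'a::{field,finite} fps"
  shows "(x + y) ^ CARD('a) = x ^ CARD('a) + y ^ CARD('a)"
proof -
  let ?q = "CARD('a)"
  have "(x + y) ^ ?q = (\<Sum>i\<le>?q. of_nat (?q choose i) * x ^ i * y ^ (?q - i))"
    by (rule binomial_ring)
  also have "\<dots> = (\<Sum>i\<in>{0, ?q}. of_nat (?q choose i) * x ^ i * y ^ (?q - i))"
  proof (intro sum.mono_neutral_right ballI)
    fix i assume "i \<in> {..?q} - {0, ?q}"
    then have "of_nat (?q choose i) = (0 :: 'a)" by (intro of_nat_card_choose_eq_0) auto
    then show "of_nat (?q choose i) * x ^ i * y ^ (?q - i) = 0"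
      by (simp flip: fps_of_nat)
  qed auto
  finally show ?thesis by (simp add: add_ac)
qed


subsection \<open>Torsion of the Carlitz module\<close>

definition carlitz :: "'a::{field,finite} fps \<Rightarrow> 'a fps \<Rightarrow> 'a fps" where
  "carlitz s y = y ^ CARD('a) + s * y"

text \<open>Here t acts as \<open>carlitz s\<close>. Only the first \<open>k\<close> coefficients of
  \<open>a\<close> enter, so this is an action of F_q[t]/t^k as soon as the \<open>k\<close>-th
  iterate kills \<open>y\<close>.\<close>

definition carlitz_act :: "'a::{field,finite} fps \<Rightarrow> nat \<Rightarrow> 'a fps \<Rightarrow> 'a fps \<Rightarrow> 'a fps" where
  "carlitz_act s k a y = (\<Sum>i<k. fps_const (fps_nth a i) * (carlitz s ^^ i) y)"

lemma carlitz_pow_0 [simp]: "(carlitz s ^^ i) 0 = 0"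
  by (induction i) (simp_all add: carlitz_def)

lemma carlitz_pow_add: "(carlitz s ^^ i) (x + y) = (carlitz s ^^ i) x + (carlitz s ^^ i) y"
  by (induction i) (simp_all add: carlitz_def fps_add_power_card algebra_simps)

lemma carlitz_pow_const_mult:
  "(carlitz s ^^ i) (fps_const c * y) = fps_const c * (carlitz s ^^ i) y"
  by (induction i)
     (simp_all add: carlitz_def power_mult_distrib fps_const_power finite_field_power_card algebra_simps)

lemma carlitz_pow_sum: "(carlitz s ^^ i) (\<Sum>j\<in>A. f j) = (\<Sum>j\<in>A. (carlitz s ^^ i) (f j))"
  by (induction A rule: infinite_finite_induct) (simp_all add: carlitz_pow_add)

lemma carlitz_pow_torsion:
  assumes "(carlitz s ^^ k) y = 0" "k \<le> i"
  shows "(carlitz s ^^ i) y = 0"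
proof -
  have "(carlitz s ^^ i) y = (carlitz s ^^ (i - k)) ((carlitz s ^^ k) y)"
    using assms(2) by (metis add.commute comp_apply funpow_add le_add_diff_inverse)
  then show ?thesis by (simp add: assms(1))
qed

lemma carlitz_act_add: "carlitz_act s k (a + b) y = carlitz_act s k a y + carlitz_act s k b y"
  by (simp add: carlitz_act_def sum.distrib algebra_simps flip: fps_const_add)

text \<open>Truncation at \<open>k\<close> is not multiplicative by itself; torsion kills the
  products with \<open>k \<le> i + j\<close>, and what remains is a Cauchy product.\<close>

lemma carlitz_act_mult:
  assumes "(carlitz s ^^ k) y = 0"
  shows "carlitz_act s k (a * b) y = carlitz_act s k a (carlitz_act s k b y)"
proof -
  let ?t = "\<lambda>i j. fps_const (fps_nth a i * fps_nth b j) * (carlitz s ^^ (i + j)) y"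
  have "carlitz_act s k a (carlitz_act s k b y) = (\<Sum>i<k. \<Sum>j<k. ?t i j)"
    by (simp add: carlitz_act_def carlitz_pow_sum carlitz_pow_const_mult sum_distrib_left
        funpow_add mult.assoc flip: fps_const_mult)
  also have "\<dots> = (\<Sum>i<k. \<Sum>j<k-i. ?t i j)"
    by (intro sum.cong refl sum.mono_neutral_right) (auto simp: carlitz_pow_torsion[OF assms])
  also have "\<dots> = (\<Sum>(i, j)\<in>(SIGMA i:{..<k}. {..<k-i}). ?t i j)"
    by (subst sum.Sigma) auto
  also have "\<dots> = (\<Sum>(m, i)\<in>(SIGMA m:{..<k}. {0..m}). ?t i (m - i))"
    by (rule sum.reindex_bij_witness[of _ "\<lambda>(m, i). (i, m - i)" "\<lambda>(i, j). (i + j, i)"]) auto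
  also have "\<dots> = (\<Sum>m<k. \<Sum>i=0..m. ?t i (m - i))"
    by (subst sum.Sigma) auto
  also have "\<dots> = (\<Sum>m<k. fps_const (fps_nth (a * b) m) * (carlitz s ^^ m) y)"
  proof (intro sum.cong refl)
    fix m
    have "(\<Sum>i=0..m. ?t i (m - i)) =
        (\<Sum>i=0..m. fps_const (fps_nth a i * fps_nth b (m - i))) * (carlitz s ^^ m) y"
      by (simp add: sum_distrib_right)
    also have "(\<Sum>i=0..m. fps_const (fps_nth a i * fps_nth b (m - i))) =
        fps_const (\<Sum>i=0..m. fps_nth a i * fps_nth b (m - i))"
      by (simp add: fps_eq_iff fps_sum_nth)
    also have "\<dots> = fps_const (fps_nth (a * b) m)" by (simp add: fps_mult_nth)
    finally show "(\<Sum>i=0..m. ?t i (m - i)) = fps_const (fps_nth (a * b) m) * (carlitz s ^^ m) y" .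
  qed
  finally show ?thesis by (simp add: carlitz_act_def)
qed

text \<open>Applying T^(k-1-i) pushes the terms above \<open>i\<close> into the torsion, the terms
  below \<open>i\<close> vanish by induction, and only a_i T^(k-1) y survives.\<close>

lemma carlitz_act_eq_0_imp:
  assumes tors: "(carlitz s ^^ k) y = 0" and nz: "(carlitz s ^^ (k - 1)) y \<noteq> 0"
    and 0: "carlitz_act s k a y = 0" and "i < k"
  shows "fps_nth a i = 0"
  using \<open>i < k\<close>
proof (induction i rule: less_induct)
  case (less i)
  have "0 = (carlitz s ^^ (k - 1 - i)) (carlitz_act s k a y)" by (simp add: 0)
  also have "\<dots> = (\<Sum>j<k. fps_const (fps_nth a j) * (carlitz s ^^ (k - 1 - i + j)) y)"
    by (simp add: carlitz_act_def carlitz_pow_sum carlitz_pow_const_mult funpow_add)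
  also have "\<dots> = (\<Sum>j\<in>{i}. fps_const (fps_nth a j) * (carlitz s ^^ (k - 1 - i + j)) y)"
  proof (intro sum.mono_neutral_right ballI)
    fix j assume j: "j \<in> {..<k} - {i}"
    show "fps_const (fps_nth a j) * (carlitz s ^^ (k - 1 - i + j)) y = 0"
    proof (cases "j < i")
      case True
      with less j show ?thesis by auto
    next
      case False
      with j less have "k \<le> k - 1 - i + j" by auto
      then show ?thesis by (simp add: carlitz_pow_torsion[OF tors])
    qed
  qed (use less in auto)
  also have "\<dots> = fps_const (fps_nth a i) * (carlitz s ^^ (k - 1)) y" using less by simp
  finally show ?case using nz by simp
qed

lemma carlitz_act_inj:
  assumes "(carlitz s ^^ k) y = 0" and "(carlitz s ^^ (k - 1)) y \<noteq> 0"
    and eq: "carlitz_act s k a y = carlitz_act s k b y" and "i < k"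
  shows "fps_nth a i = fps_nth b i"
proof -
  have "carlitz_act s k (a - b) y + carlitz_act s k b y = carlitz_act s k a y"
    by (simp flip: carlitz_act_add)
  then have "carlitz_act s k (a - b) y = 0" using eq by simp
  then have "fps_nth (a - b) i = 0" by (rule carlitz_act_eq_0_imp[OF assms(1,2) _ \<open>i < k\<close>])
  then show ?thesis by simp
qed

section \<open>X-adic contractions and the choice of the parameter \<open>s\<close>\<close>

lemma fps_X_power_dvd_iff: "fps_X ^ m dvd (f :: 'a::field fps) \<longleftrightarrow> (\<forall>i<m. fps_nth f i = 0)"
proof
  assume "fps_X ^ m dvd f"
  then show "\<forall>i<m. fps_nth f i = 0" by (auto simp: fps_X_power_mult_nth elim!: dvdE)
next
  assume "\<forall>i<m. fps_nth f i = 0"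
  then have "f = fps_X ^ m * fps_shift m f"
    by (auto simp: fps_eq_iff fps_X_power_mult_nth)
  then show "fps_X ^ m dvd f" by (rule dvdI)
qed

text \<open>Banach's fixed point theorem for the X-adic metric: the iterates from 0 stabilise
  coefficient by coefficient.\<close>

lemma fps_contraction_fixpoint:
  fixes F :: "'a::field fps \<Rightarrow> 'a fps"
  assumes F: "\<And>a b m. fps_X ^ m dvd (a - b) \<Longrightarrow> fps_X ^ Suc m dvd (F a - F b)"
  shows "\<exists>a. F a = a"
proof -
  define u where "u n = (F ^^ n) 0" for n
  have step: "fps_X ^ n dvd (u (n + j) - u n)" for n j
  proof (induction n)
    case (Suc n)
    then show ?case using F[OF Suc.IH] by (simp add: u_def)
  qed simp
  \<comment> \<open>Coefficient \<open>i\<close> is the same in all iterates from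
    \<open>Suc i\<close> on, so the limit reads it off there.\<close>
  define a where "a = Abs_fps (\<lambda>i. fps_nth (u (Suc i)) i)"
  have a: "fps_X ^ n dvd (a - u n)" for n
  proof -
    have "fps_nth (u n) i = fps_nth (u (Suc i)) i" if "i < n" for i
      using step[of "Suc i" "n - Suc i"] that by (auto simp: fps_X_power_dvd_iff simp del: power_Suc)
    then show ?thesis by (simp add: fps_X_power_dvd_iff a_def)
  qed
  have "fps_nth (F a) n = fps_nth a n" for n
  proof -
    have "fps_X ^ Suc n dvd (F a - u (Suc n))"
      using F[OF a[of n]] by (simp add: u_def)
    with a[of "Suc n"] show ?thesis by (auto simp: fps_X_power_dvd_iff simp del: power_Suc)
  qed
  then have "F a = a" by (simp add: fps_eq_iff)
  then show ?thesis ..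
qed

text \<open>In s y - s' y' = s (y - y') + (s - s') y' the last term gains one power of X because y'
  is divisible by X. This gain turns the equation for \<open>s\<close> into a contraction. The
  second conjunct carries the divisibility through the induction.\<close>

lemma carlitz_pow_cong:
  assumes "fps_X ^ m dvd (s - s')" and "fps_X dvd y"
  shows "fps_X ^ Suc m dvd ((carlitz s ^^ i) y - (carlitz s' ^^ i) y) \<and> fps_X dvd (carlitz s' ^^ i) y"
proof (induction i)
  case (Suc i)
  let ?y = "(carlitz s ^^ i) y" and ?y' = "(carlitz s' ^^ i) y"
  have "carlitz s ?y - carlitz s' ?y' = (?y ^ CARD('a) - ?y' ^ CARD('a)) + s * (?y - ?y') + (s - s') * ?y'"
    by (simp add: carlitz_def algebra_simps)
  moreover have "fps_X ^ Suc m dvd (?y ^ CARD('a) - ?y' ^ CARD('a))"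
    using Suc by (metis dvd_mult2 power_diff_sumr2)
  moreover have "fps_X ^ Suc m dvd s * (?y - ?y')" using Suc by (intro dvd_mult) auto
  moreover have "fps_X ^ Suc m dvd (s - s') * ?y'"
    using mult_dvd_mono[OF assms(1) conjunct2[OF Suc.IH]] by (simp add: mult.commute)
  moreover have "fps_X dvd carlitz s' ?y'"
    unfolding carlitz_def[of s' ?y'] using Suc
    by (intro dvd_add dvd_mult dvd_power_le[of fps_X ?y' 1 "CARD('a)", simplified]) (auto simp: Suc_leI)
  ultimately show ?case by (auto intro!: dvd_add)
qed (use assms in auto)

text \<open>
  The parameter \<open>s\<close> is the solution of \<open>s = -\<mu>^(q - 1)\<close> where \<open>\<mu> = T^(k - 1) X\<close> and
  \<open>T y = y^q + s y\<close>, so that \<open>T \<mu> = 0\<close>.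
\<close>

lemma carlitz_torsion_exists:
  assumes "k > 0"
  obtains s :: "'a::{field,finite} fps" where "fps_nth s 0 = 0"
    "(carlitz s ^^ k) fps_X = 0" "(carlitz s ^^ (k - 1)) fps_X \<noteq> 0"
proof -
  define F :: "'a fps \<Rightarrow> 'a fps" where "F s = - (((carlitz s ^^ (k - 1)) fps_X) ^ (CARD('a) - 1))" for s
  have "\<exists>s. F s = s"
  proof (rule fps_contraction_fixpoint)
    fix a b :: "'a fps" and m assume "fps_X ^ m dvd (a - b)"
    then have "fps_X ^ Suc m dvd ((carlitz b ^^ (k - 1)) fps_X - (carlitz a ^^ (k - 1)) fps_X)"
      using carlitz_pow_cong[of m b a fps_X "k - 1"] by (simp add: dvd_diff_commute)
    then have "fps_X ^ Suc m dvd (((carlitz b ^^ (k - 1)) fps_X) ^ (CARD('a) - 1)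
        - ((carlitz a ^^ (k - 1)) fps_X) ^ (CARD('a) - 1))"
      by (metis dvd_mult2 power_diff_sumr2)
    then show "fps_X ^ Suc m dvd (F a - F b)" by (simp add: F_def)
  qed
  then obtain s where s: "F s = s" ..
  define \<mu> where "\<mu> = (carlitz s ^^ (k - 1)) fps_X"
  have s_eq: "s = - (\<mu> ^ (CARD('a) - 1))" using s by (simp add: F_def \<mu>_def)
  have q1: "CARD('a) - 1 > 0" using card_field_ge_2[where 'a = 'a] by simp
  have "fps_X dvd \<mu>" using carlitz_pow_cong[of 0 s s fps_X "k - 1"] by (simp add: \<mu>_def)
  then have "fps_nth \<mu> 0 = 0" using fps_X_power_dvd_iff[of 1 \<mu>] by simp
  then have 1: "fps_nth s 0 = 0" using q1 by (simp add: s_eq fps_nth_power_0)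
  have "(carlitz s ^^ k) fps_X = carlitz s \<mu>"
    using assms by (cases k) (auto simp: \<mu>_def)
  also have "\<dots> = \<mu> * \<mu> ^ (CARD('a) - 1) + s * \<mu>"
    using q1 by (simp add: carlitz_def flip: power_Suc)
  also have "\<dots> = 0" by (simp add: s_eq)
  finally have 2: "(carlitz s ^^ k) fps_X = 0" .
  \<comment> \<open>If \<open>\<mu>\<close> vanished, so would \<open>s\<close>; then T is the plain
    q-th power and T^(k-1) X is a power of X, which is not 0.\<close>
  have "\<mu> \<noteq> 0"
  proof
    assume "\<mu> = 0"
    then have "s = 0" using s_eq q1 by simp
    then have "(carlitz s ^^ i) fps_X = fps_X ^ (CARD('a) ^ i)" for i
      by (induction i) (simp_all add: carlitz_def power_mult[symmetric] mult.commute)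
    then have "\<mu> = fps_X ^ (CARD('a) ^ (k - 1))" by (simp add: \<mu>_def)
    with \<open>\<mu> = 0\<close> show False by simp
  qed
  then have 3: "(carlitz s ^^ (k - 1)) fps_X \<noteq> 0" by (simp add: \<mu>_def)
  show ?thesis using 1 2 3 by (rule that)
qed


subsection \<open>Truncated orders of power series\<close>

text \<open>The cap \<open>M\<close> gives the zero series a finite order, so that orders can be
  summed over all directions.\<close>

definition trunc_order :: "nat \<Rightarrow> 'a::field fps \<Rightarrow> nat" where
  "trunc_order M f = (if f = 0 then M else min M (subdegree f))"

lemma trunc_order_le: "trunc_order M f \<le> M"
  by (simp add: trunc_order_def)

lemma trunc_order_mult_le: "trunc_order M (f * g) \<le> trunc_order M f + trunc_order M g"
  by (auto simp: trunc_order_def)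

lemma trunc_order_fps_X_power: "trunc_order M (fps_X ^ e) = min M e"
  by (simp add: trunc_order_def)

lemma trunc_order_unit: "fps_nth f 0 \<noteq> 0 \<Longrightarrow> trunc_order M f = 0"
  by (auto simp: trunc_order_def)

lemma trunc_order_eqI:
  assumes "fps_X ^ M dvd f"
  shows "trunc_order M f = M"
  using assms by (auto simp: trunc_order_def fps_X_power_dvd_iff intro!: min_absorb1 subdegree_geI)

text \<open>The exponent \<open>e\<close> is the least order in the family; dividing by X^e leaves a
  family that is not zero modulo X.\<close>

lemma fps_family_primitive:
  fixes c :: "'b \<Rightarrow> 'a::field fps"
  assumes "finite S" "i \<in> S" "c i \<noteq> 0"
  obtains e where "\<forall>i\<in>S. c i = fps_X ^ e * fps_shift e (c i)"
    and "\<exists>i\<in>S. fps_nth (c i) e \<noteq> 0"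
proof -
  let ?Z = "{i\<in>S. c i \<noteq> 0}"
  define i0 where "i0 = arg_min_on (\<lambda>i. subdegree (c i)) ?Z"
  have Z: "finite ?Z" "?Z \<noteq> {}" using assms by auto
  have i0: "i0 \<in> ?Z" "\<And>i. i \<in> ?Z \<Longrightarrow> subdegree (c i0) \<le> subdegree (c i)"
    unfolding i0_def using arg_min_if_finite[OF Z, of "\<lambda>i. subdegree (c i)"] by (auto simp: not_less)
  show ?thesis
  proof (rule that)
    show "\<forall>i\<in>S. c i = fps_X ^ subdegree (c i0) * fps_shift (subdegree (c i0)) (c i)"
    proof
      fix i assume "i \<in> S"
      show "c i = fps_X ^ subdegree (c i0) * fps_shift (subdegree (c i0)) (c i)"
      proof (cases "c i = 0")
        case False
        then have "subdegree (c i0) \<le> subdegree (c i)" using \<open>i \<in> S\<close> i0(2) by simp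
        then show ?thesis by (subst mult.commute) (rule subdegree_decompose')
      qed simp
    qed
    show "\<exists>i\<in>S. fps_nth (c i) (subdegree (c i0)) \<noteq> 0"
      using i0(1) by (intro bexI[of _ i0]) auto
  qed
qed


subsection \<open>Reduction of polynomials over power series\<close>

definition fps_reduce :: "'a::field fps poly \<Rightarrow> 'a poly" where
  "fps_reduce p = map_poly (\<lambda>f. fps_nth f 0) p"

lemma coeff_fps_reduce [simp]: "coeff (fps_reduce p) i = fps_nth (coeff p i) 0"
  by (simp add: fps_reduce_def coeff_map_poly)

lemma fps_reduce_0 [simp]: "fps_reduce 0 = 0"
  by (simp add: poly_eq_iff)

lemma fps_reduce_1 [simp]: "fps_reduce 1 = 1"
  by (simp add: poly_eq_iff)

lemma fps_reduce_pCons [simp]: "fps_reduce (pCons a p) = pCons (fps_nth a 0) (fps_reduce p)"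
  by (simp add: poly_eq_iff coeff_pCons split: nat.split)

lemma fps_reduce_add: "fps_reduce (p + r) = fps_reduce p + fps_reduce r"
  by (simp add: poly_eq_iff)

lemma fps_reduce_smult: "fps_reduce (smult c p) = smult (fps_nth c 0) (fps_reduce p)"
  by (simp add: poly_eq_iff)

lemma fps_reduce_mult: "fps_reduce (p * r) = fps_reduce p * fps_reduce r"
  by (simp add: poly_eq_iff coeff_mult fps_sum_nth)

lemma fps_reduce_power: "fps_reduce (p ^ n) = fps_reduce p ^ n"
  by (induction n) (simp_all add: fps_reduce_mult)

lemma fps_reduce_sum: "fps_reduce (\<Sum>i\<in>A. f i) = (\<Sum>i\<in>A. fps_reduce (f i))"
  by (induction A rule: infinite_finite_induct) (simp_all add: fps_reduce_add)

lemma fps_reduce_prod: "fps_reduce (\<Prod>i\<in>A. f i) = (\<Prod>i\<in>A. fps_reduce (f i))"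
  by (induction A rule: infinite_finite_induct) (simp_all add: fps_reduce_mult)

lemma fps_reduce_pcompose: "fps_reduce (pcompose p r) = pcompose (fps_reduce p) (fps_reduce r)"
  by (induction p) (simp_all add: pcompose_pCons fps_reduce_add fps_reduce_mult)

lemma fps_poly_primitive:
  fixes p :: "'a::field fps poly"
  assumes "p \<noteq> 0"
  obtains e p1 where "p = smult (fps_X ^ e) p1" "fps_reduce p1 \<noteq> 0"
proof -
  have "finite {..degree p}" "degree p \<in> {..degree p}" "coeff p (degree p) \<noteq> 0" using assms by simp_all
  then obtain e where e: "\<forall>i\<in>{..degree p}. coeff p i = fps_X ^ e * fps_shift e (coeff p i)"
      "\<exists>i\<in>{..degree p}. fps_nth (coeff p i) e \<noteq> 0"
    by (rule fps_family_primitive)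
  define p1 where "p1 = map_poly (fps_shift e) p"
  have co: "coeff p1 i = fps_shift e (coeff p i)" for i
    by (simp add: p1_def coeff_map_poly)
  have "coeff p i = fps_X ^ e * coeff p1 i" for i
    unfolding co using e(1) by (cases "i \<le> degree p") (blast intro: atMost_iff[THEN iffD2], simp add: coeff_eq_0)
  then have "p = smult (fps_X ^ e) p1" by (simp add: poly_eq_iff)
  moreover have "fps_reduce p1 \<noteq> 0"
    using e(2) by (auto simp: poly_eq_iff co)
  ultimately show ?thesis by (rule that)
qed

lemma coeff_order_0:
  fixes p :: "'a::field poly"
  assumes "p \<noteq> 0"
  shows "coeff p (order 0 p) \<noteq> 0"
proof -
  obtain r where r: "p = [:- 0, 1:] ^ order 0 p * r" "\<not> [:- 0, 1:] dvd r"
    using order_decomp[OF assms] by blast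
  define n where "n = order 0 p"
  have "p = monom 1 n * r" using r(1) by (simp add: monom_altdef n_def)
  then have "coeff p n = coeff r 0" by (simp add: coeff_monom_mult)
  moreover have "coeff r 0 \<noteq> 0" using r(2) poly_eq_0_iff_dvd[of r 0] by (simp add: poly_0_coeff_0)
  ultimately show ?thesis by (simp add: n_def)
qed

lemma order_0_pcompose_shift:
  fixes p :: "'a::field poly"
  assumes "p \<noteq> 0"
  shows "order 0 (pcompose p [:c, 1:]) = order c p"
proof -
  obtain r where r: "p = [:- c, 1:] ^ order c p * r" "\<not> [:- c, 1:] dvd r"
    using order_decomp[OF assms] by blast
  have "poly r c \<noteq> 0" using r(2) by (simp flip: poly_eq_0_iff_dvd)
  moreover from this have "order 0 (pcompose r [:c, 1:]) = 0"
    by (intro order_0I) (simp add: poly_pcompose)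
  moreover have "r \<noteq> 0" using \<open>poly r c \<noteq> 0\<close> by auto
  moreover have "pcompose p [:c, 1:] = [:- 0, 1:] ^ order c p * pcompose r [:c, 1:]"
  proof -
    have "pcompose (s ^ n) [:c, 1:] = pcompose s [:c, 1:] ^ n" for s :: "'a poly" and n
      by (induction n) (simp_all add: pcompose_mult pcompose_1)
    then show ?thesis
      using arg_cong[OF r(1), of "\<lambda>p. pcompose p [:c, 1:]"] by (simp add: pcompose_mult pcompose_pCons)
  qed
  moreover have "pcompose r [:c, 1:] \<noteq> 0"
    using \<open>r \<noteq> 0\<close> pcompose_eq_0[of r "[:c, 1:]"] by auto
  ultimately show ?thesis
    using order_power_n_n[of "0::'a" "order c p"] by (simp add: order_mult)
qed

lemma sum_order_UNIV_le_degree: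
  fixes p :: "'a::{field,finite} poly"
  assumes "p \<noteq> 0"
  shows "(\<Sum>c\<in>UNIV. order c p) \<le> degree p"
proof -
  have "(\<Sum>c\<in>UNIV. order c p) = (\<Sum>c | poly p c = 0. order c p)"
    by (intro sum.mono_neutral_right) (auto simp: order_root)
  also have "\<dots> \<le> degree p" using assms by (rule sum_order_le_degree)
  finally show ?thesis .
qed


subsection \<open>Averages of truncated orders\<close>

text \<open>
  With gaps \<open>a\<^sub>1, a\<^sub>2, \<dots>\<close> the digits \<open>c\<^sub>1, c\<^sub>2, \<dots>\<close> give
  \<open>c\<^sub>1 X^a\<^sub>1 + c\<^sub>2 X^(a\<^sub>1 + a\<^sub>2) + \<dots>\<close>.
\<close>

fun digit_series :: "nat list \<Rightarrow> 'a::field list \<Rightarrow> 'a fps" where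
  "digit_series (a # as) (c # cs) = fps_X ^ a * (fps_const c + digit_series as cs)"
| "digit_series _ _ = 0"

text \<open>The power of \<open>q\<close> counts the choices for the digit right after the gap and
  for the \<open>length as\<close> later ones; each choice pays at most the gap once per unit of
  order at 0.\<close>

fun gap_weight :: "nat \<Rightarrow> nat list \<Rightarrow> nat" where
  "gap_weight q [] = 0"
| "gap_weight q (a # as) = a * q ^ Suc (length as) + gap_weight q as"

lemma sum_lists_Suc:
  fixes f :: "'a::finite list \<Rightarrow> nat"
  shows "(\<Sum>cs | length cs = Suc n. f cs) = (\<Sum>c\<in>UNIV. \<Sum>cs | length cs = n. f (c # cs))"
proof -
  have "(\<Sum>cs | length cs = Suc n. f cs) = (\<Sum>(c, cs)\<in>UNIV \<times> {cs. length cs = n}. f (c # cs))"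
    by (rule sum.reindex_bij_witness[of _ "\<lambda>(c, cs). c # cs" "\<lambda>cs. (hd cs, tl cs)"])
       (auto simp: length_Suc_conv)
  then show ?thesis by (simp add: sum.cartesian_product)
qed

lemma card_lists_length: "card {cs :: 'a::finite list. length cs = n} = CARD('a) ^ n"
  using card_lists_length_eq[of "UNIV :: 'a set" n] by simp

lemma finite_lists_length [simp]: "finite {cs :: 'a::finite list. length cs = n}"
  using finite_lists_length_eq[of "UNIV :: 'a set" n] by simp

text \<open>
  Rescaling by the first gap, \<open>p (X^a y) = X^e p\<^sub>1 y\<close> with \<open>e \<le> a r\<close> where \<open>r\<close> is the order at \<open>0\<close>
  of the reduction of \<open>p\<close>; the reduction of \<open>p\<^sub>1\<close> has degree at most \<open>r\<close>, so the
  orders of its roots, one for each choice of the next digit, add up to at most \<open>r\<close>.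
\<close>

lemma sum_trunc_order_primitive:
  fixes p :: "'a::{field,finite} fps poly"
  assumes "fps_reduce p \<noteq> 0" "\<And>a. a \<in> set as \<Longrightarrow> a > 0"
  shows "(\<Sum>cs | length cs = length as. trunc_order M (poly p (digit_series as cs)))
           \<le> order 0 (fps_reduce p) * (gap_weight CARD('a) as + M)"
  using assms
proof (induction as arbitrary: p)
  case Nil
  \<comment> \<open>Order 0 makes the constant term a unit, so the left side is 0; otherwise the
    right side is at least the cap.\<close>
  have "trunc_order M (poly p 0) \<le> order 0 (fps_reduce p) * M"
  proof (cases "order 0 (fps_reduce p) = 0")
    case True
    then have "fps_nth (poly p 0) 0 \<noteq> 0"
      using coeff_order_0[OF Nil.prems(1)] by (simp add: poly_0_coeff_0)
    then show ?thesis by (simp add: trunc_order_unit)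
  next
    case False
    then have "M \<le> order 0 (fps_reduce p) * M" by simp
    with trunc_order_le show ?thesis by (rule order_trans)
  qed
  then show ?case by simp
next
  case (Cons a as)
  define r where "r = order 0 (fps_reduce p)"
  define W where "W = gap_weight CARD('a) as + M"
  have r: "fps_nth (coeff p r) 0 \<noteq> 0" using coeff_order_0[OF Cons.prems(1)] by (simp add: r_def)
  define p' where "p' = pcompose p [:0, fps_X ^ a:]"
  have co: "coeff p' i = fps_X ^ (a * i) * coeff p i" for i
    by (simp add: p'_def coeff_pcompose_linear power_mult)
  have "coeff p' r \<noteq> 0" using r by (auto simp: co)
  then have "p' \<noteq> 0" by auto
  then obtain e p1 where p1: "p' = smult (fps_X ^ e) p1" "fps_reduce p1 \<noteq> 0"
    by (rule fps_poly_primitive)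
  have co1: "fps_X ^ e * coeff p1 i = fps_X ^ (a * i) * coeff p i" for i
    using co[of i] p1(1) by simp
  \<comment> \<open>The coefficient of index \<open>r\<close> has a nonzero constant term, so its
    order after rescaling is exactly \<open>a * r\<close>; the common factor X^e cannot exceed
    it.\<close>
  have e: "e \<le> a * r"
  proof (rule ccontr)
    assume "\<not> e \<le> a * r"
    then have "fps_nth (fps_X ^ e * coeff p1 r) (a * r) = 0" by (simp add: fps_X_power_mult_nth)
    with r show False unfolding co1 by (simp add: fps_X_power_mult_nth)
  qed
  \<comment> \<open>Coefficients of index \<open>j > r\<close> are divisible by X^(a j) with
    \<open>e < a * j\<close>, so they still vanish modulo X after division by X^e.\<close>
  have "degree (fps_reduce p1) \<le> r"
  proof (rule degree_le, intro allI impI)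
    fix j assume "r < j"
    then have "e < a * j" using e Cons.prems(2)[of a] by (metis le_less_trans list.set_intros(1) mult_less_cancel1)
    then have "fps_nth (fps_X ^ e * coeff p1 j) e = 0" unfolding co1 by (simp add: fps_X_power_mult_nth)
    then show "coeff (fps_reduce p1) j = 0" by (simp add: fps_X_power_mult_nth)
  qed
  then have ord: "(\<Sum>c\<in>UNIV. order c (fps_reduce p1)) \<le> r"
    using sum_order_UNIV_le_degree[OF p1(2)] by simp
  \<comment> \<open>Recentring at the digit \<open>c\<close> prepares the induction hypothesis for
    the remaining digits: the order at 0 is now the order of \<open>fps_reduce p1\<close> at
    \<open>c\<close>.\<close>
  define pc where "pc c = pcompose p1 [:fps_const c, 1:]" for c
  have red_pc: "fps_reduce (pc c) = pcompose (fps_reduce p1) [:c, 1:]" for c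
    by (simp add: pc_def fps_reduce_pcompose)
  have ord_pc: "order 0 (fps_reduce (pc c)) = order c (fps_reduce p1)" for c
    unfolding red_pc using p1(2) by (rule order_0_pcompose_shift)
  have nz_pc: "fps_reduce (pc c) \<noteq> 0" for c
    using p1(2) pcompose_eq_0[of "fps_reduce p1" "[:c, 1:]"] by (auto simp: red_pc)
  have ev: "poly p (digit_series (a # as) (c # cs)) = fps_X ^ e * poly (pc c) (digit_series as cs)" for c cs
  proof -
    let ?y = "fps_const c + digit_series as cs"
    have "poly p (fps_X ^ a * ?y) = poly p' ?y" by (simp add: p'_def poly_pcompose mult.commute)
    also have "\<dots> = fps_X ^ e * poly p1 ?y" by (simp add: p1(1))
    finally show ?thesis by (simp add: pc_def poly_pcompose add.commute)
  qed
  have "(\<Sum>cs | length cs = length (a # as). trunc_order M (poly p (digit_series (a # as) cs))) =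
      (\<Sum>c\<in>UNIV. \<Sum>cs | length cs = length as. trunc_order M (fps_X ^ e * poly (pc c) (digit_series as cs)))"
    by (simp only: length_Cons sum_lists_Suc ev)
  also have "\<dots> \<le> (\<Sum>c\<in>UNIV. \<Sum>cs | length cs = length as. e + trunc_order M (poly (pc c) (digit_series as cs)))"
  proof (intro sum_mono)
    fix c and cs :: "'a list"
    have "trunc_order M (fps_X ^ e * poly (pc c) (digit_series as cs)) \<le>
        min M e + trunc_order M (poly (pc c) (digit_series as cs))"
      using trunc_order_mult_le by (metis trunc_order_fps_X_power)
    then show "trunc_order M (fps_X ^ e * poly (pc c) (digit_series as cs)) \<le>
        e + trunc_order M (poly (pc c) (digit_series as cs))" by simp
  qed
  also have "\<dots> \<le> (\<Sum>c\<in>UNIV. e * CARD('a) ^ length as + order c (fps_reduce p1) * W)"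
  proof (intro sum_mono)
    fix c
    have "(\<Sum>cs | length cs = length as. trunc_order M (poly (pc c) (digit_series as cs)))
        \<le> order 0 (fps_reduce (pc c)) * W"
      unfolding W_def by (rule Cons.IH[OF nz_pc]) (use Cons.prems(2) in auto)
    then show "(\<Sum>cs | length cs = length as. e + trunc_order M (poly (pc c) (digit_series as cs)))
        \<le> e * CARD('a) ^ length as + order c (fps_reduce p1) * W"
      by (simp add: sum.distrib card_lists_length ord_pc)
  qed
  also have "\<dots> = e * CARD('a) ^ Suc (length as) + (\<Sum>c\<in>UNIV. order c (fps_reduce p1)) * W"
    by (simp add: sum.distrib sum_distrib_right)
  also have "\<dots> \<le> a * r * CARD('a) ^ Suc (length as) + r * W"
    using e ord by (intro add_mono mult_right_mono) auto
  also have "\<dots> = r * (gap_weight CARD('a) (a # as) + M)" by (simp add: W_def algebra_simps)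
  finally show ?case by (simp add: r_def)
qed

text \<open>Write p = X^e p1 with p1 nonzero modulo X: X^e divides the coefficient of index
  \<open>m\<close>, and the reduction of p1 has order at most \<open>m\<close> at 0. If that
  coefficient is 0, its truncated order is the cap and the bound is trivial. With several variables
  the coefficient is a polynomial in the others.\<close>

lemma sum_trunc_order_degree:
  fixes p :: "'a::{field,finite} fps poly"
  assumes deg: "degree p \<le> m" and pos: "\<And>a. a \<in> set as \<Longrightarrow> a > 0"
  shows "(\<Sum>cs | length cs = length as. trunc_order M (poly p (digit_series as cs)))
           \<le> CARD('a) ^ length as * trunc_order M (coeff p m) + m * (gap_weight CARD('a) as + M)"
proof (cases "coeff p m = 0")
  case True
  have "(\<Sum>cs | length cs = length as. trunc_order M (poly p (digit_series as cs)))
      \<le> (\<Sum>cs :: 'a list | length cs = length as. M)"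
    by (intro sum_mono trunc_order_le)
  also have "\<dots> = CARD('a) ^ length as * trunc_order M (coeff p m)"
    using True by (simp add: card_lists_length trunc_order_def)
  finally show ?thesis by simp
next
  case False
  then have "p \<noteq> 0" by auto
  then obtain e p1 where p1: "p = smult (fps_X ^ e) p1" "fps_reduce p1 \<noteq> 0"
    by (rule fps_poly_primitive)
  have "order 0 (fps_reduce p1) \<le> degree (fps_reduce p1)" using p1(2) by (rule order_degree)
  also have "\<dots> \<le> degree p1" unfolding fps_reduce_def by (rule map_poly_degree_leq)
  also have "\<dots> \<le> m" using deg p1(1) by simp
  finally have ord: "order 0 (fps_reduce p1) \<le> m" .
  have "coeff p m = fps_X ^ e * coeff p1 m" by (simp add: p1(1))
  then have e: "min M e \<le> trunc_order M (coeff p m)" using False by (auto simp: trunc_order_def)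
  have "(\<Sum>cs | length cs = length as. trunc_order M (poly p (digit_series as cs)))
      \<le> (\<Sum>cs | length cs = length as. trunc_order M (coeff p m) + trunc_order M (poly p1 (digit_series as cs)))"
  proof (intro sum_mono)
    fix cs :: "'a list"
    have "trunc_order M (poly p (digit_series as cs)) \<le> min M e + trunc_order M (poly p1 (digit_series as cs))"
      using trunc_order_mult_le[of M "fps_X ^ e" "poly p1 (digit_series as cs)"]
      by (simp add: p1(1) trunc_order_fps_X_power)
    with e show "trunc_order M (poly p (digit_series as cs))
        \<le> trunc_order M (coeff p m) + trunc_order M (poly p1 (digit_series as cs))" by linarith
  qed
  also have "\<dots> \<le> CARD('a) ^ length as * trunc_order M (coeff p m)
      + order 0 (fps_reduce p1) * (gap_weight CARD('a) as + M)"
    using sum_trunc_order_primitive[OF p1(2) pos, of as M] by (simp add: sum.distrib card_lists_length)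
  also have "\<dots> \<le> CARD('a) ^ length as * trunc_order M (coeff p m) + m * (gap_weight CARD('a) as + M)"
    using ord by (intro add_mono mult_right_mono) auto
  finally show ?thesis .
qed

text \<open>Induction on the variables as for the Schwartz-Zippel lemma: averaging over variable
  \<open>j\<close> costs \<open>m * \<beta>\<close> and leaves the coefficient of its highest power
  \<open>m\<close>, of total degree at most \<open>d - m\<close>. The injectivity hypothesis says
  that members of \<open>S\<close> are distinct monomials in the variables of
  \<open>I\<close>.\<close>

lemma sum_trunc_order_multivariate:
  fixes c :: "('i \<Rightarrow> nat) \<Rightarrow> 'a::{field,finite}"
  defines "L n \<equiv> {cs :: 'a list. length cs = n}"
  assumes "finite I" "finite S" "S \<noteq> {}" "inj_on (\<lambda>\<alpha>. restrict \<alpha> I) S"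
    and "\<And>\<alpha>. \<alpha> \<in> S \<Longrightarrow> c \<alpha> \<noteq> 0" and "\<And>\<alpha>. \<alpha> \<in> S \<Longrightarrow> (\<Sum>i\<in>I. \<alpha> i) \<le> d"
    and pos: "\<And>a. a \<in> set as \<Longrightarrow> a > 0"
    and \<beta>: "gap_weight CARD('a) as + M \<le> \<beta> * CARD('a) ^ length as"
  shows "(\<Sum>w\<in>PiE I (\<lambda>_. L (length as)).
            trunc_order M (\<Sum>\<alpha>\<in>S. fps_const (c \<alpha>) * (\<Prod>i\<in>I. digit_series as (w i) ^ \<alpha> i)))
          \<le> d * \<beta> * (CARD('a) ^ length as) ^ card I"
  using assms(2-7)
proof (induction I arbitrary: S d rule: finite_induct)
  case empty
  \<comment> \<open>Without variables all exponents agree, so the sum is a single nonzero constant,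
    of order 0.\<close>
  then obtain \<alpha> where "S = {\<alpha>}"
    by (auto simp: inj_on_def)
  with empty show ?case by (simp add: trunc_order_unit)
next
  case (insert j I)
  let ?N = "CARD('a) ^ length as"
  define m where "m = Max ((\<lambda>\<alpha>. \<alpha> j) ` S)"
  have m: "\<alpha> j \<le> m" if "\<alpha> \<in> S" for \<alpha> using that insert.prems by (simp add: m_def)
  have "m \<in> (\<lambda>\<alpha>. \<alpha> j) ` S" unfolding m_def using insert.prems by (intro Max_in) auto
  then obtain \<alpha>0 where \<alpha>0: "\<alpha>0 \<in> S" "\<alpha>0 j = m" by auto
  have md: "m \<le> d" using insert.prems(5)[OF \<alpha>0(1)] insert.hyps \<alpha>0(2) by simp
  define S' where "S' = {\<alpha>\<in>S. \<alpha> j = m}"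
  define t where "t w \<alpha> = fps_const (c \<alpha>) * (\<Prod>i\<in>I. digit_series as (w i) ^ \<alpha> i)" for w \<alpha>
  define p where "p w = (\<Sum>\<alpha>\<in>S. monom (t w \<alpha>) (\<alpha> j))" for w
  have deg: "degree (p w) \<le> m" for w
    unfolding p_def using m insert.prems(1)
    by (intro degree_sum_le) (auto intro: order_trans[OF degree_monom_le])
  have lead: "coeff (p w) m = (\<Sum>\<alpha>\<in>S'. t w \<alpha>)" for w
    using insert.prems(1) by (simp add: p_def S'_def coeff_sum sum.inter_filter)
  have IH: "(\<Sum>w\<in>PiE I (\<lambda>_. L (length as)). trunc_order M (\<Sum>\<alpha>\<in>S'. t w \<alpha>))
      \<le> (d - m) * \<beta> * ?N ^ card I"
    unfolding t_def
  proof (rule insert.IH)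
    \<comment> \<open>Members of \<open>S'\<close> share the exponent \<open>m\<close> at
      \<open>j\<close>, so they already differ on \<open>I\<close>.\<close>
    show "inj_on (\<lambda>\<alpha>. restrict \<alpha> I) S'"
    proof (rule inj_onI)
      fix \<alpha> \<alpha>' assume \<alpha>: "\<alpha> \<in> S'" "\<alpha>' \<in> S'" and eq: "restrict \<alpha> I = restrict \<alpha>' I"
      have "restrict \<alpha> (insert j I) = restrict \<alpha>' (insert j I)"
      proof
        fix i show "restrict \<alpha> (insert j I) i = restrict \<alpha>' (insert j I) i"
          using fun_cong[OF eq, of i] \<alpha> by (auto simp: S'_def restrict_def split: if_splits)
      qed
      then show "\<alpha> = \<alpha>'" by (rule inj_onD[OF insert.prems(3)]) (use \<alpha> in \<open>auto simp: S'_def\<close>)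
    qed
    show "(\<Sum>i\<in>I. \<alpha> i) \<le> d - m" if "\<alpha> \<in> S'" for \<alpha>
      using that insert.prems(5)[of \<alpha>] insert.hyps by (auto simp: S'_def)
  qed (use insert.prems \<alpha>0 in \<open>auto simp: S'_def\<close>)
  have ev: "(\<Sum>\<alpha>\<in>S. fps_const (c \<alpha>) * (\<Prod>i\<in>insert j I. digit_series as ((w(j := cs)) i) ^ \<alpha> i))
      = poly (p w) (digit_series as cs)" for w cs
  proof -
    have "(\<Prod>i\<in>I. digit_series as ((w(j := cs)) i) ^ \<alpha> i) = (\<Prod>i\<in>I. digit_series as (w i) ^ \<alpha> i)" for \<alpha>
      using insert.hyps by (intro prod.cong) auto
    then show ?thesis
      using insert.hyps by (simp add: p_def poly_sum poly_monom t_def algebra_simps)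
  qed
  have "(\<Sum>w\<in>PiE (insert j I) (\<lambda>_. L (length as)).
          trunc_order M (\<Sum>\<alpha>\<in>S. fps_const (c \<alpha>) * (\<Prod>i\<in>insert j I. digit_series as (w i) ^ \<alpha> i)))
      = (\<Sum>(cs, w)\<in>L (length as) \<times> PiE I (\<lambda>_. L (length as)).
          trunc_order M (\<Sum>\<alpha>\<in>S. fps_const (c \<alpha>) * (\<Prod>i\<in>insert j I. digit_series as ((w(j := cs)) i) ^ \<alpha> i)))"
    unfolding PiE_insert_eq
    by (subst sum.reindex[OF inj_combinator[OF insert.hyps(2)]]) (simp add: case_prod_unfold)
  also have "\<dots> = (\<Sum>w\<in>PiE I (\<lambda>_. L (length as)). \<Sum>cs\<in>L (length as). trunc_order M (poly (p w) (digit_series as cs)))"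
    unfolding ev by (simp add: sum.cartesian_product[symmetric] sum.swap[of _ "L (length as)"])
  also have "\<dots> \<le> (\<Sum>w\<in>PiE I (\<lambda>_. L (length as)). ?N * trunc_order M (\<Sum>\<alpha>\<in>S'. t w \<alpha>) + m * (\<beta> * ?N))"
  proof (intro sum_mono)
    fix w
    have "(\<Sum>cs\<in>L (length as). trunc_order M (poly (p w) (digit_series as cs)))
        \<le> ?N * trunc_order M (coeff (p w) m) + m * (gap_weight CARD('a) as + M)"
      unfolding L_def using deg pos by (rule sum_trunc_order_degree)
    also have "\<dots> \<le> ?N * trunc_order M (coeff (p w) m) + m * (\<beta> * ?N)"
      using \<beta> by (intro add_mono mult_left_mono) auto
    finally show "(\<Sum>cs\<in>L (length as). trunc_order M (poly (p w) (digit_series as cs)))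
        \<le> ?N * trunc_order M (\<Sum>\<alpha>\<in>S'. t w \<alpha>) + m * (\<beta> * ?N)" by (simp only: lead)
  qed
  also have "\<dots> = ?N * (\<Sum>w\<in>PiE I (\<lambda>_. L (length as)). trunc_order M (\<Sum>\<alpha>\<in>S'. t w \<alpha>))
      + ?N ^ card I * (m * (\<beta> * ?N))"
    using insert.hyps by (simp add: sum.distrib sum_distrib_left card_PiE L_def card_lists_length)
  also have "\<dots> \<le> ?N * ((d - m) * \<beta> * ?N ^ card I) + ?N ^ card I * (m * (\<beta> * ?N))"
    using IH by (intro add_mono mult_left_mono) auto
  also have "\<dots> = ((d - m) + m) * \<beta> * ?N ^ card (insert j I)"
    using insert.hyps by (simp add: algebra_simps)
  also have "(d - m) + m = d" using md by simp
  finally show ?case .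
qed

text \<open>The gaps between the exponents \<open>1, q, q\<^sup>2, \<dots>\<close>\<close>

definition frobenius_gaps :: "nat \<Rightarrow> nat \<Rightarrow> nat list" where
  "frobenius_gaps q k = map (\<lambda>i. if i = 0 then 1 else q ^ i - q ^ (i - 1)) [0..<k]"

text \<open>The gaps are differences of \<open>b\<close>, so the exponents telescope; the prefactor
  X^(b l) is the exponent reached before position \<open>l\<close> and lets the induction move the
  start.\<close>

lemma digit_series_gaps:
  assumes "mono b"
  shows "fps_X ^ b l * digit_series (map (\<lambda>i. b (Suc i) - b i) [l..<l + n]) (map f [l..<l + n])
           = (\<Sum>i=l..<l + n. fps_const (f i) * fps_X ^ b (Suc i))"
proof (induction n arbitrary: l)
  case (Suc n)
  have up: "[l..<l + Suc n] = l # [Suc l..<Suc l + n]" by (simp add: upt_conv_Cons)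
  have b: "b l \<le> b (Suc l)" using assms by (simp add: monoD)
  have "fps_X ^ b l * digit_series (map (\<lambda>i. b (Suc i) - b i) [l..<l + Suc n]) (map f [l..<l + Suc n])
      = fps_X ^ (b l + (b (Suc l) - b l)) * (fps_const (f l) + digit_series
          (map (\<lambda>i. b (Suc i) - b i) [Suc l..<Suc l + n]) (map f [Suc l..<Suc l + n]))"
    unfolding up by (simp add: power_add mult.assoc del: upt_Suc)
  also have "\<dots> = fps_const (f l) * fps_X ^ b (Suc l) + (\<Sum>i=Suc l..<Suc l + n. fps_const (f i) * fps_X ^ b (Suc i))"
    using b Suc.IH[of "Suc l"] by (simp add: distrib_left mult.commute del: upt_Suc)
  also have "\<dots> = (\<Sum>i=l..<l + Suc n. fps_const (f i) * fps_X ^ b (Suc i))"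
    using sum.atLeast_Suc_lessThan[of l "l + Suc n" "\<lambda>i. fps_const (f i) * fps_X ^ b (Suc i)"] by simp
  finally show ?case .
qed simp

lemma digit_series_frobenius_gaps:
  assumes "q > 0"
  shows "digit_series (frobenius_gaps q k) (map f [0..<k]) = (\<Sum>i<k. fps_const (f i) * fps_X ^ (q ^ i))"
proof -
  \<comment> \<open>The shift by one with starting value 0 makes the first gap 1 and puts digit
    \<open>i\<close> at the exponent \<open>b (Suc i) = q ^ i\<close>.\<close>
  define b where "b i = (if i = 0 then 0 else q ^ (i - 1))" for i :: nat
  have "b i \<le> b (Suc i)" for i
    using assms by (auto simp: b_def intro: power_increasing)
  then have "mono b" by (simp add: mono_iff_le_Suc)
  moreover have "frobenius_gaps q k = map (\<lambda>i. b (Suc i) - b i) [0..<0 + k]"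
    by (simp add: frobenius_gaps_def b_def)
  ultimately show ?thesis
    using digit_series_gaps[of b 0 k f] by (simp add: b_def atLeast0LessThan)
qed

text \<open>The gap at position \<open>i\<close> is at most q^i and has weight q^(l+n-i), so each of
  the \<open>n\<close> gaps contributes at most q^(l+n).\<close>

lemma gap_weight_le:
  assumes "\<And>i. g i \<le> q ^ i"
  shows "gap_weight q (map g [l..<l + n]) \<le> n * q ^ (l + n)"
proof (induction n arbitrary: l)
  case (Suc n)
  have up: "[l..<l + Suc n] = l # [Suc l..<Suc l + n]" by (simp add: upt_conv_Cons)
  have "gap_weight q (map g [l..<l + Suc n]) = g l * q ^ Suc n + gap_weight q (map g [Suc l..<Suc l + n])"
    unfolding up by (simp del: upt_Suc)
  also have "\<dots> \<le> q ^ l * q ^ Suc n + n * q ^ (Suc l + n)"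
    using assms Suc.IH[of "Suc l"] by (intro add_mono mult_right_mono) auto
  also have "\<dots> = Suc n * q ^ (l + Suc n)" by (simp add: power_add algebra_simps)
  finally show ?case .
qed simp

lemma gap_weight_frobenius_gaps: "gap_weight q (frobenius_gaps q k) \<le> k * q ^ k"
  using gap_weight_le[of "\<lambda>i. if i = 0 then 1 else q ^ i - q ^ (i - 1)" q 0 k]
  by (simp add: frobenius_gaps_def)

lemma frobenius_gaps_pos:
  assumes "q \<ge> 2" "a \<in> set (frobenius_gaps q k)"
  shows "a > 0"
  using assms by (auto simp: frobenius_gaps_def intro!: power_strict_increasing)

lemma length_frobenius_gaps [simp]: "length (frobenius_gaps q k) = k"
  by (simp add: frobenius_gaps_def)


subsection \<open>Linear systems and monomials\<close>

text \<open>The coefficients lie only in a domain, so elimination proceeds by cross multiplication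
  instead of division.\<close>

lemma homogeneous_system_nontrivial:
  fixes A :: "'e \<Rightarrow> 's \<Rightarrow> 'r::idom"
  assumes "finite T" "finite S" "card T < card S"
  shows "\<exists>c. (\<exists>s\<in>S. c s \<noteq> 0) \<and> (\<forall>e\<in>T. (\<Sum>s\<in>S. c s * A e s) = 0)"
  using assms
proof (induction T arbitrary: S A rule: finite_induct)
  case empty
  then obtain s where "s \<in> S" by fastforce
  then show ?case by (intro exI[of _ "\<lambda>_. 1"]) auto
next
  case (insert e T)
  show ?case
  proof (cases "\<forall>s\<in>S. A e s = 0")
    case True
    moreover have "card T < card S" using insert by simp
    ultimately show ?thesis using insert.IH[OF insert.prems(1), of A] by auto
  next
    case False
    then obtain s0 where s0: "s0 \<in> S" "A e s0 \<noteq> 0" by blast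
    define S' where "S' = S - {s0}"
    have S: "S = insert s0 S'" "s0 \<notin> S'" "finite S'" using s0 insert.prems by (auto simp: S'_def)
    \<comment> \<open>Row \<open>e'\<close> with the unknown \<open>s0\<close> eliminated through
      row \<open>e\<close>; row \<open>e\<close> itself becomes 0.\<close>
    define B where "B e' s = A e s0 * A e' s - A e' s0 * A e s" for e' s
    have "card T < card S'" using insert S by simp
    then obtain c where c: "\<exists>s\<in>S'. c s \<noteq> 0" "\<And>e'. e' \<in> T \<Longrightarrow> (\<Sum>s\<in>S'. c s * B e' s) = 0"
      using insert.IH[OF S(3), of B] by blast
    \<comment> \<open>The value at \<open>s0\<close> solves row \<open>e\<close> once the other
      unknowns are scaled by the pivot \<open>A e s0\<close>; in a domain a nonzero pivot keeps the
      solution nontrivial.\<close>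
    define c' where "c' s = (if s = s0 then - (\<Sum>s\<in>S'. c s * A e s) else A e s0 * c s)" for s
    have sum: "(\<Sum>s\<in>S. c' s * A e' s) = (\<Sum>s\<in>S'. c s * B e' s)" for e'
    proof -
      have "(\<Sum>s\<in>S'. c' s * A e' s) = (\<Sum>s\<in>S'. A e s0 * c s * A e' s)"
        using S(2) by (intro sum.cong) (auto simp: c'_def)
      then have "(\<Sum>s\<in>S. c' s * A e' s) =
          (\<Sum>s\<in>S'. A e s0 * c s * A e' s) - (\<Sum>s\<in>S'. c s * A e s) * A e' s0"
        using S by (simp add: c'_def)
      also have "\<dots> = (\<Sum>s\<in>S'. A e s0 * c s * A e' s - c s * A e s * A e' s0)"
        by (simp only: sum_distrib_right sum_subtractf)
      also have "\<dots> = (\<Sum>s\<in>S'. c s * B e' s)"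
        by (intro sum.cong refl) (simp add: B_def algebra_simps)
      finally show ?thesis .
    qed
    have "\<exists>s\<in>S. c' s \<noteq> 0" using c(1) s0(2) S by (auto simp: c'_def)
    moreover have "(\<Sum>s\<in>S'. c s * B e s) = 0" by (simp add: B_def)
    ultimately show ?thesis using c(2) sum by (intro exI[of _ c']) auto
  qed
qed

lemma finite_exponents: "finite {\<alpha> :: 'n::finite \<Rightarrow> nat. (\<Sum>j\<in>UNIV. \<alpha> j) \<le> d}"
proof (rule finite_subset)
  show "{\<alpha> :: 'n \<Rightarrow> nat. (\<Sum>j\<in>UNIV. \<alpha> j) \<le> d} \<subseteq> PiE UNIV (\<lambda>_. {..d})"
  proof
    fix \<alpha> :: "'n \<Rightarrow> nat" assume \<alpha>: "\<alpha> \<in> {\<alpha>. (\<Sum>j\<in>UNIV. \<alpha> j) \<le> d}"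
    have "\<alpha> j \<le> d" for j
    proof -
      have "\<alpha> j \<le> (\<Sum>j\<in>UNIV. \<alpha> j)" by (rule member_le_sum) auto
      also have "\<dots> \<le> d" using \<alpha> by simp
      finally show ?thesis .
    qed
    then show "\<alpha> \<in> PiE UNIV (\<lambda>_. {..d})" by auto
  qed
  show "finite (PiE UNIV (\<lambda>_ :: 'n. {..d}))" by (intro finite_PiE) auto
qed

text \<open>Stars and bars: an extra slack coordinate turns the degree bound into an equality for
  lists of length n + 1.\<close>

lemma card_exponents_ge:
  "(d + CARD('n)) choose CARD('n) \<le> card {\<alpha> :: 'n::finite \<Rightarrow> nat. (\<Sum>j\<in>UNIV. \<alpha> j) \<le> d}"
proof -
  let ?n = "CARD('n)"
  let ?L = "{l :: nat list. length l = Suc ?n \<and> sum_list l = d}"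
  obtain h :: "'n \<Rightarrow> nat" where h: "bij_betw h UNIV {0..<?n}"
    using ex_bij_betw_finite_nat[of "UNIV :: 'n set"] by auto
  define f where "f l = (\<lambda>j. l ! h j)" for l :: "nat list"
  have split: "sum_list l = (\<Sum>j\<in>UNIV. f l j) + l ! ?n" if "length l = Suc ?n" for l
  proof -
    have "sum_list l = (\<Sum>i=0..<?n. l ! i) + l ! ?n" by (simp add: sum_list_sum_nth that)
    also have "(\<Sum>i=0..<?n. l ! i) = (\<Sum>j\<in>UNIV. f l j)"
      unfolding f_def by (rule sum.reindex_bij_betw[OF h, symmetric])
    finally show ?thesis .
  qed
  have "inj_on f ?L"
  proof (rule inj_onI)
    fix l l' assume l: "l \<in> ?L" "l' \<in> ?L" and eq: "f l = f l'"
    show "l = l'"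
    proof (rule nth_equalityI)
      fix i assume "i < length l"
      then consider "i < ?n" | "i = ?n" using l by fastforce
      then show "l ! i = l' ! i"
      proof cases
        case 1
        then obtain j where "h j = i" using h by (metis atLeastLessThan_iff bij_betw_iff_bijections le0)
        then show ?thesis using fun_cong[OF eq, of j] by (simp add: f_def)
      next
        case 2
        then show ?thesis using split[of l] split[of l'] l eq by simp
      qed
    qed (use l in simp)
  qed
  moreover have "f ` ?L \<subseteq> {\<alpha>. (\<Sum>j\<in>UNIV. \<alpha> j) \<le> d}" using split by fastforce
  ultimately have "card ?L \<le> card {\<alpha> :: 'n \<Rightarrow> nat. (\<Sum>j\<in>UNIV. \<alpha> j) \<le> d}"
    by (rule card_inj_on_le[OF _ _ finite_exponents])
  moreover have "card ?L = (d + ?n) choose d" using card_length_sum_list[of "Suc ?n" d] by simp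
  moreover have "(d + ?n) choose d = (d + ?n) choose ?n" using binomial_symmetric[of d "d + ?n"] by simp
  ultimately show ?thesis by simp
qed


subsection \<open>Haar measure and truncation\<close>

text \<open>The fibres of \<open>tr\<close> are translates of one another, so each has measure 1 /
  \<open>card D\<close>, and \<open>X\<close> is covered by the fibres it meets. This turns measure
  into a count of residue classes modulo t^k.\<close>

lemma haar_measure_le_card:
  fixes tr :: "'g::{topological_space,ab_group_add} \<Rightarrow> 'd"
  assumes haar: "normalized_haar G M" and D: "finite D" "tr ` G = D"
    and grp: "\<And>x y. x \<in> G \<Longrightarrow> y \<in> G \<Longrightarrow> x + y \<in> G" "\<And>x y. x \<in> G \<Longrightarrow> y \<in> G \<Longrightarrow> x - y \<in> G"
    and meas: "\<And>d. d \<in> D \<Longrightarrow> {x\<in>G. tr x = d} \<in> sets M"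
    and trans: "\<And>g x y. tr x = tr y \<Longrightarrow> tr (g + x) = tr (g + y)"
    and X: "X \<in> sets M"
  shows "measure M X * real (card D) \<le> real (card (tr ` X))"
proof -
  have sets: "sets M = sets (restrict_space borel G)" and one: "emeasure M G = 1"
    and inv: "\<And>g X. g \<in> G \<Longrightarrow> X \<in> sets M \<Longrightarrow> emeasure M ((\<lambda>x. g + x) ` X) = emeasure M X"
    using haar by (auto simp: normalized_haar_def)
  have sp: "space M = G" using sets_eq_imp_space_eq[OF sets] by (simp add: space_restrict_space)
  interpret prob_space M by (rule prob_spaceI) (simp add: sp one)
  define F where "F d = {x\<in>G. tr x = d}" for d
  have F: "F d \<in> sets M" if "d \<in> D" for d using meas that by (simp add: F_def)
  have XG: "X \<subseteq> G" using sets.sets_into_space[OF X] sp by simp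
  have dis: "disjoint_family_on F A" for A by (auto simp: disjoint_family_on_def F_def)
  have eq: "measure M (F d) = measure M (F d')" if "d \<in> D" "d' \<in> D" for d d'
  proof -
    have "d \<in> tr ` G" "d' \<in> tr ` G" using that D(2) by simp_all
    then obtain x x' where x: "x \<in> G" "tr x = d" "x' \<in> G" "tr x' = d'" by blast
    have "(\<lambda>z. (x' - x) + z) ` F d = F d'"
    proof (intro set_eqI iffI)
      fix y assume "y \<in> (\<lambda>z. (x' - x) + z) ` F d"
      then obtain z where z: "y = (x' - x) + z" "z \<in> G" "tr z = tr x" using x by (auto simp: F_def)
      then have "tr y = tr x'" using trans[of z x "x' - x"] by simp
      then show "y \<in> F d'" using z x grp by (auto simp: F_def)
    next
      fix y assume y: "y \<in> F d'"
      then have "tr y = tr x'" using x by (simp add: F_def)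
      then have "tr (y - (x' - x)) = tr x" using trans[of y x' "x - x'"] by (simp add: algebra_simps)
      then have "y - (x' - x) \<in> F d" using x y grp by (auto simp: F_def)
      then show "y \<in> (\<lambda>z. (x' - x) + z) ` F d" by (intro image_eqI[of _ _ "y - (x' - x)"]) auto
    qed
    then have "emeasure M (F d') = emeasure M (F d)"
      using inv[of "x' - x" "F d"] F[OF that(1)] grp x by auto
    then show ?thesis by (simp add: measure_def)
  qed
  have ne: "D \<noteq> {}" using D(2) one by (auto simp: emeasure_empty)
  then obtain d0 where d0: "d0 \<in> D" by blast
  define m where "m = measure M (F d0)"
  have m: "measure M (F d) = m" if "d \<in> D" for d using eq[OF that d0] by (simp add: m_def)
  have un: "measure M (\<Union>d\<in>A. F d) = real (card A) * m" if "A \<subseteq> D" for A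
  proof -
    have "measure M (\<Union>d\<in>A. F d) = (\<Sum>d\<in>A. measure M (F d))"
      using that D F by (intro finite_measure_finite_Union dis) (auto intro: finite_subset)
    also have "\<dots> = (\<Sum>d\<in>A. m)" using that m by (intro sum.cong) auto
    finally show ?thesis by simp
  qed
  have "(\<Union>d\<in>D. F d) = G" using D by (auto simp: F_def)
  then have 1: "real (card D) * m = 1" using un[of D] prob_space by (simp add: sp)
  have sub: "tr ` X \<subseteq> D" using XG D by auto
  have "X \<subseteq> (\<Union>d\<in>tr ` X. F d)" using XG by (auto simp: F_def)
  moreover have "(\<Union>d\<in>tr ` X. F d) \<in> sets M"
    using sub F D by (intro sets.finite_UN) (auto intro: finite_subset)
  ultimately have "measure M X \<le> real (card (tr ` X)) * m"
    using finite_measure_mono[of X "\<Union>d\<in>tr ` X. F d"] un[OF sub] by simp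
  then have "measure M X * real (card D) \<le> real (card (tr ` X)) * m * real (card D)"
    by (rule mult_right_mono) simp
  also have "\<dots> = real (card (tr ` X)) * (real (card D) * m)" by (simp only: mult_ac)
  finally show ?thesis using 1 by simp
qed

section \<open>Digits of Laurent series and truncation modulo t^k\<close>

definition fls_digits :: "nat \<Rightarrow> 'a::zero fls \<Rightarrow> 'a list" where
  "fls_digits k x = map (\<lambda>i. fls_nth x (int i)) [0..<k]"

lemma fls_digits_eq_iff: "fls_digits k x = fls_digits k y \<longleftrightarrow> (\<forall>i<k. fls_nth x (int i) = fls_nth y (int i))"
  by (auto simp: fls_digits_def)

lemma length_fls_digits [simp]: "length (fls_digits k x) = k"
  by (simp add: fls_digits_def)

lemma fls_digits_add_cong:
  "fls_digits k x = fls_digits k y \<Longrightarrow> fls_digits k (g + x) = fls_digits k (g + (y :: 'a::group_add fls))"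
  by (simp add: fls_digits_eq_iff)

lemma fls_digits_surj:
  assumes "length (cs :: 'a::{field,finite} list) = k"
  shows "\<exists>x\<in>power_series. fls_digits k x = cs"
proof
  let ?x = "fps_to_fls (Abs_fps (\<lambda>i. cs ! i))"
  show "fls_digits k ?x = cs" using assms by (intro nth_equalityI) (auto simp: fls_digits_def)
  show "?x \<in> power_series" by (simp add: power_series_def)
qed

text \<open>A distance below 2^(-k) in the base 2 metric forces agreement of the first
  \<open>k\<close> digits. Hence residue classes modulo t^k are Borel sets.\<close>

lemma open_fls_digits: "open {x :: 'a::group_add fls. fls_digits k x = cs}"
  unfolding open_dist
proof (intro ballI)
  fix x :: "'a fls" assume x: "x \<in> {x. fls_digits k x = cs}"
  have "fls_digits k y = cs" if d: "dist y x < inverse (2 ^ k)" for y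
  proof (cases "y = x")
    case False
    have "fls_subdegree (y - x) \<ge> 0"
    proof (rule ccontr)
      assume neg: "\<not> ?thesis"
      then have "1 \<le> dist y x" using False by (simp add: dist_fls_def)
      moreover have "inverse (2 ^ k) \<le> (1 :: real)" by (simp add: field_simps)
      ultimately show False using d by simp
    qed
    then have "(2 :: real) ^ k < 2 ^ nat (fls_subdegree (y - x))"
      using d False by (simp add: dist_fls_def)
    then have "int k < fls_subdegree (y - x)" by simp
    then have "fls_nth (y - x) (int i) = 0" if "i < k" for i
      using that by (intro fls_eq0_below_subdegree) simp
    then have "fls_digits k y = fls_digits k x" by (simp add: fls_digits_eq_iff)
    then show ?thesis using x by simp
  qed (use x in simp)
  then show "\<exists>e>0. \<forall>y. dist y x < e \<longrightarrow> y \<in> {x. fls_digits k x = cs}"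
    by (intro exI[of _ "inverse (2 ^ k)"]) auto
qed

lemma power_series_diff: "x \<in> power_series \<Longrightarrow> y \<in> power_series \<Longrightarrow> x - y \<in> power_series"
  using power_series_add[of y "x - y"] by simp

lemma haar_power_series_le:
  fixes X :: "'a::{field,finite} fls set"
  assumes "X \<in> sets (haar power_series)"
  shows "measure (haar power_series) X * real CARD('a) ^ k \<le> real (card (fls_digits k ` X))"
proof -
  have sets: "sets (haar (power_series :: 'a fls set)) = sets (restrict_space borel power_series)"
    using normalized_haar_haar[where 'a = 'a] by (simp add: normalized_haar_def)
  have "measure (haar power_series) X * real (card {cs :: 'a list. length cs = k}) \<le> real (card (fls_digits k ` X))"
  proof (rule haar_measure_le_card[OF normalized_haar_haar])
    show "fls_digits k ` power_series = {cs :: 'a list. length cs = k}"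
    proof (intro equalityI subsetI)
      fix cs :: "'a list" assume "cs \<in> {cs. length cs = k}"
      then obtain x where "x \<in> power_series" "fls_digits k x = cs" using fls_digits_surj[of cs k] by auto
      then show "cs \<in> fls_digits k ` power_series" by blast
    qed auto
    show "{x \<in> power_series. fls_digits k x = cs} \<in> sets (haar (power_series :: 'a fls set))" for cs
    proof -
      have "power_series \<inter> {x :: 'a fls. fls_digits k x = cs} \<in> sets (restrict_space borel power_series)"
        unfolding sets_restrict_space by (intro imageI borel_open open_fls_digits)
      then show ?thesis by (simp add: sets Int_def)
    qed
    show "finite {cs :: 'a list. length cs = k}"
      using finite_lists_length_eq[of "UNIV :: 'a set" k] by simp
  qed (use assms power_series_add power_series_diff in \<open>auto intro: fls_digits_add_cong\<close>)
  then show ?thesis using card_lists_length_eq[of "UNIV :: 'a set" k] by simp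
qed

lemma haar_power_series_vecs_le:
  fixes X :: "('a::{field,finite} fls ^ 'n) set"
  assumes "X \<in> sets (haar power_series_vecs)"
  shows "measure (haar power_series_vecs) X * (real CARD('a) ^ k) ^ CARD('n)
           \<le> real (card ((\<lambda>x j. fls_digits k (x $ j)) ` X))"
proof -
  let ?V = "power_series_vecs :: ('a fls ^ 'n) set"
  let ?D = "PiE UNIV (\<lambda>_ :: 'n. {cs :: 'a list. length cs = k})"
  let ?tr = "\<lambda>(x :: 'a fls ^ 'n) j. fls_digits k (x $ j)"
  have sets: "sets (haar ?V) = sets (restrict_space borel ?V)"
    using normalized_haar_haar_vecs unfolding normalized_haar_def by blast
  have fin: "finite {cs :: 'a list. length cs = k}"
    using finite_lists_length_eq[of "UNIV :: 'a set" k] by simp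
  have "measure (haar power_series_vecs) X * real (card ?D) \<le> real (card (?tr ` X))"
  proof (rule haar_measure_le_card[OF normalized_haar_haar_vecs])
    show "?tr ` ?V = ?D"
    proof (intro equalityI subsetI)
      fix d assume d: "d \<in> ?D"
      then have "\<forall>j. \<exists>x\<in>power_series. fls_digits k x = d j" by (intro allI fls_digits_surj) (auto simp: PiE_def Pi_def)
      then obtain x where "\<And>j. x j \<in> power_series \<and> fls_digits k (x j) = d j" by metis
      then show "d \<in> ?tr ` ?V"
        by (intro image_eqI[of _ _ "\<chi> j. x j"]) (auto simp: power_series_vecs_def)
    qed auto
    show "{x \<in> ?V. ?tr x = d} \<in> sets (haar ?V)" for d
    proof -
      have "{x :: 'a fls ^ 'n. ?tr x = d} = {x. \<forall>j. x $ j \<in> {y. fls_digits k y = d j}}"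
        by (auto simp: fun_eq_iff)
      moreover have "open {x :: 'a fls ^ 'n. \<forall>j. x $ j \<in> {y. fls_digits k y = d j}}"
        by (intro open_vector_box allI open_fls_digits)
      ultimately have "open {x :: 'a fls ^ 'n. ?tr x = d}" by simp
      then have "?V \<inter> {x. ?tr x = d} \<in> sets (restrict_space borel ?V)"
        unfolding sets_restrict_space by (intro imageI borel_open)
      then show ?thesis by (simp add: sets Int_def)
    qed
    show "?tr (g + x) = ?tr (g + y)" if "?tr x = ?tr y" for g x y
      using that by (auto simp: fun_eq_iff intro: fls_digits_add_cong)
    show "finite ?D" using fin by (intro finite_PiE) auto
    show "x + y \<in> ?V" "x - y \<in> ?V" if "x \<in> ?V" "y \<in> ?V" for x y
      using that by (simp_all add: power_series_vecs_def power_series_add power_series_diff)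
  qed (rule assms)
  then show ?thesis
    using card_lists_length_eq[of "UNIV :: 'a set" k] by (simp add: card_PiE)
qed


subsection \<open>Restriction to lines\<close>

text \<open>The iterates of T as polynomials in the argument, so that their coefficients can be
  reduced modulo X.\<close>

primrec carlitz_poly :: "'a::{field,finite} fps \<Rightarrow> nat \<Rightarrow> 'a fps poly" where
  "carlitz_poly s 0 = [:0, 1:]"
| "carlitz_poly s (Suc i) = carlitz_poly s i ^ CARD('a) + smult s (carlitz_poly s i)"

definition carlitz_act_poly :: "'a::{field,finite} fps \<Rightarrow> nat \<Rightarrow> 'a fps \<Rightarrow> 'a fps poly" where
  "carlitz_act_poly s k a = (\<Sum>i<k. smult (fps_const (fps_nth a i)) (carlitz_poly s i))"

lemma poly_carlitz_poly: "poly (carlitz_poly s i) y = (carlitz s ^^ i) y"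
  by (induction i) (simp_all add: carlitz_def poly_power)

lemma poly_carlitz_act_poly: "poly (carlitz_act_poly s k a) y = carlitz_act s k a y"
  by (simp add: carlitz_act_poly_def carlitz_act_def poly_sum poly_carlitz_poly)

text \<open>As \<open>s\<close> vanishes modulo X, T reduces to the plain q-th power.\<close>

lemma fps_reduce_carlitz_poly:
  fixes s :: "'a::{field,finite} fps"
  assumes "fps_nth s 0 = 0"
  shows "fps_reduce (carlitz_poly s i) = monom 1 (CARD('a) ^ i)"
proof (induction i)
  case 0
  then show ?case by (simp add: monom_altdef)
next
  case (Suc i)
  then show ?case
    by (simp add: assms fps_reduce_add fps_reduce_power fps_reduce_smult monom_power mult.commute)
qed

lemma fps_reduce_carlitz_act_poly:
  fixes s :: "'a::{field,finite} fps"
  assumes "fps_nth s 0 = 0"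
  shows "fps_of_poly (fps_reduce (carlitz_act_poly s k a)) =
    digit_series (frobenius_gaps CARD('a) k) (map (fps_nth a) [0..<k])"
  by (simp add: carlitz_act_poly_def fps_reduce_sum fps_reduce_smult fps_reduce_carlitz_poly[OF assms]
      fps_of_poly_sum fps_of_poly_smult fps_of_poly_monom' digit_series_frobenius_gaps)

lemma fps_nth_0_carlitz_act: "fps_nth (carlitz_act s k a fps_X) 0 = 0"
proof -
  have "fps_nth ((carlitz s ^^ i) fps_X) 0 = 0" for i
    using carlitz_pow_cong[of 0 s s fps_X i] fps_X_power_dvd_iff[of 1 "(carlitz s ^^ i) fps_X"] by simp
  then show ?thesis by (simp add: carlitz_act_def fps_sum_nth)
qed

lemma carlitz_act_cong:
  "(\<And>i. i < k \<Longrightarrow> fps_nth a i = fps_nth b i) \<Longrightarrow> carlitz_act s k a y = carlitz_act s k b y"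
  by (simp add: carlitz_act_def)

lemma prod_linear_factors_dvd:
  fixes p :: "'a::idom poly"
  assumes "finite Z" "\<And>z. z \<in> Z \<Longrightarrow> poly p z = 0"
  shows "(\<Prod>z\<in>Z. [:- z, 1:]) dvd p"
  using assms
proof (induction Z rule: finite_induct)
  case (insert z Z)
  then obtain h where h: "p = (\<Prod>z\<in>Z. [:- z, 1:]) * h" by (auto elim: dvdE)
  have "poly (\<Prod>z\<in>Z. [:- z, 1:]) z \<noteq> 0" using insert.hyps by (auto simp: poly_prod)
  moreover have "poly p z = 0" using insert.prems by simp
  ultimately have "poly h z = 0" by (simp add: h)
  then have "[:- z, 1:] dvd h" by (simp add: poly_eq_0_iff_dvd)
  then have "(\<Prod>z\<in>Z. [:- z, 1:]) * [:- z, 1:] dvd p" unfolding h by (rule mult_dvd_mono[OF dvd_refl])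
  then show ?case using insert.hyps by (simp add: mult.commute)
qed simp

text \<open>
  All torsion points reduce to \<open>0\<close>, so each point of the line contributes one factor \<open>X\<close> to the
  reduction.
\<close>

lemma line_vanishing:
  fixes s :: "'a::{field,finite} fps" and k :: nat and c :: "('n::finite \<Rightarrow> nat) \<Rightarrow> 'a fps"
  defines "\<phi> \<equiv> \<lambda>a. carlitz_act s k a fps_X"
  assumes s: "fps_nth s 0 = 0" "(carlitz s ^^ k) fps_X = 0"
    and fin: "finite (\<phi> ` J)"
    and van: "\<And>x. x \<in> J \<Longrightarrow> (\<Sum>\<alpha>\<in>S. c \<alpha> * (\<Prod>j\<in>UNIV. \<phi> (b j + w j * x) ^ \<alpha> j)) = 0"
  shows "fps_X ^ card (\<phi> ` J) dvd
    (\<Sum>\<alpha>\<in>S. fps_const (fps_nth (c \<alpha>) 0) *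
      (\<Prod>j\<in>UNIV. digit_series (frobenius_gaps CARD('a) k) (map (fps_nth (w j)) [0..<k]) ^ \<alpha> j))"
proof -
  \<comment> \<open>The restriction to the line as a polynomial in the single variable
    \<open>z = \<phi> x\<close>: multiplication by \<open>w j\<close> acts on \<open>z\<close>
    through \<open>carlitz_act_poly s k (w j)\<close>.\<close>
  define g where "g = (\<Sum>\<alpha>\<in>S. smult (c \<alpha>) (\<Prod>j\<in>UNIV. ([:\<phi> (b j):] + carlitz_act_poly s k (w j)) ^ \<alpha> j))"
  have "poly g z = 0" if z: "z \<in> \<phi> ` J" for z
  proof -
    obtain x where x: "x \<in> J" "z = \<phi> x" using z by blast
    have "\<phi> (b j + w j * x) = \<phi> (b j) + poly (carlitz_act_poly s k (w j)) z" for j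
      by (simp add: \<phi>_def carlitz_act_add carlitz_act_mult[OF s(2)] poly_carlitz_act_poly x(2))
    then show ?thesis
      using van[OF x(1)] by (simp add: g_def poly_sum poly_prod poly_power)
  qed
  then have "(\<Prod>z\<in>\<phi> ` J. [:- z, 1:]) dvd g" by (rule prod_linear_factors_dvd[OF fin])
  then obtain h where h: "g = (\<Prod>z\<in>\<phi> ` J. [:- z, 1:]) * h" by (rule dvdE)
  have "fps_reduce (\<Prod>z\<in>\<phi> ` J. [:- z, 1:]) = (\<Prod>z\<in>\<phi> ` J. [:0, 1:])"
    unfolding fps_reduce_prod by (intro prod.cong refl) (auto simp: \<phi>_def fps_nth_0_carlitz_act)
  then have "fps_of_poly (fps_reduce g) = fps_X ^ card (\<phi> ` J) * fps_of_poly (fps_reduce h)"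
    by (simp add: h fps_reduce_mult fps_of_poly_mult fps_of_poly_power)
  moreover have "fps_of_poly (fps_reduce g) = (\<Sum>\<alpha>\<in>S. fps_const (fps_nth (c \<alpha>) 0) *
      (\<Prod>j\<in>UNIV. digit_series (frobenius_gaps CARD('a) k) (map (fps_nth (w j)) [0..<k]) ^ \<alpha> j))"
    by (simp add: g_def fps_reduce_sum fps_reduce_smult fps_reduce_prod fps_reduce_power fps_reduce_add
        fps_of_poly_sum fps_of_poly_smult fps_of_poly_prod fps_of_poly_power
        fps_reduce_carlitz_act_poly[OF s(1)] \<phi>_def fps_nth_0_carlitz_act)
  ultimately show ?thesis by (metis dvd_triv_left)
qed


subsection \<open>Kakeya sets\<close>

lemma sup_cball_digits:
  fixes x :: "'a::{field,finite} fls ^ 'n"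
  assumes "x \<in> sup_cball c (real CARD('a) powi (- int k))" "i < k"
  shows "fls_nth (x $ j) (int i) = fls_nth (c $ j) (int i)"
proof (cases "(x - c) $ j = 0")
  case False
  have q: "1 < real CARD('a)" using card_field_ge_2[where 'a = 'a] by linarith
  have "fls_abs ((x - c) $ j) \<le> sup_norm (x - c)"
    unfolding sup_norm_def by (intro Max_ge) auto
  also have "\<dots> \<le> real CARD('a) powi (- int k)" using assms(1) by (simp add: sup_cball_def)
  finally have "real CARD('a) powi (- fls_subdegree ((x - c) $ j)) \<le> real CARD('a) powi (- int k)"
    using False by (simp add: fls_abs_def)
  then have "- fls_subdegree ((x - c) $ j) \<le> - int k"
    using power_int_strict_increasing[OF _ q] by (meson not_le)
  then have "fls_nth ((x - c) $ j) (int i) = 0" using assms(2) by (intro fls_eq0_below_subdegree) simp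
  then show ?thesis by simp
qed simp

lemma card_image_le_card_cover:
  assumes "finite \<B>" "E \<subseteq> \<Union>\<B>" and const: "\<And>B x y. B \<in> \<B> \<Longrightarrow> x \<in> B \<Longrightarrow> y \<in> B \<Longrightarrow> f x = f y"
  shows "finite (f ` E)" "card (f ` E) \<le> card \<B>"
proof -
  have "f ` E \<subseteq> (\<lambda>B. f (SOME x. x \<in> B)) ` \<B>"
  proof
    fix z assume "z \<in> f ` E"
    then obtain x B where x: "z = f x" "x \<in> B" "B \<in> \<B>" using assms(2) by blast
    then have "(SOME x. x \<in> B) \<in> B" by (intro someI)
    then show "z \<in> (\<lambda>B. f (SOME x. x \<in> B)) ` \<B>" using x const by blast
  qed
  moreover have "finite ((\<lambda>B. f (SOME x. x \<in> B)) ` \<B>)" using assms(1) by simp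
  ultimately show "finite (f ` E)" "card (f ` E) \<le> card \<B>"
    using assms(1) by (meson finite_subset card_mono card_image_le order_trans)+
qed

lemma power_series_mult: "x \<in> power_series \<Longrightarrow> y \<in> power_series \<Longrightarrow> x * y \<in> power_series"
  unfolding power_series_def by (auto simp flip: fls_times_fps_to_fls)

lemma map_nth_fls_regpart: "map (fps_nth (fls_regpart x)) [0..<k] = fls_digits k x"
  by (simp add: fls_digits_def)

lemma fls_regpart_mult:
  assumes "x \<in> power_series" "y \<in> power_series"
  shows "fls_regpart (x * y) = fls_regpart x * fls_regpart y"
  using assms by (auto simp: power_series_def simp flip: fls_times_fps_to_fls)

text \<open>For \<open>k = 1\<close> the floor vanishes; for \<open>k \<ge> 2\<close> the spare factor \<open>q \<ge> 2\<close> exceeds \<open>(k + 1) / k\<close>.\<close>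

lemma kakeya_arith:
  fixes \<epsilon> \<nu> q :: real and k n :: nat
  assumes "k > 0" "n > 0" "q \<ge> 2" "\<epsilon> \<in> {0<..<1}" "\<nu> \<in> {0<..<1}"
    and d: "d = nat \<lfloor>\<nu> * \<epsilon> / (real k * real n) * q ^ (k - 1)\<rfloor>"
  shows "real d * real (Suc k) < \<nu> * \<epsilon> * q ^ k"
proof (cases "d = 0")
  case True
  then show ?thesis using assms by simp
next
  case False
  have ve: "0 < \<nu> * \<epsilon>" "\<nu> * \<epsilon> < 1" using assms(4,5) mult_strict_mono[of \<nu> 1 \<epsilon> 1] by auto
  have "real d \<le> \<nu> * \<epsilon> / (real k * real n) * q ^ (k - 1)"
    using False d by linarith
  then have le: "real d * (real k * real n) \<le> \<nu> * \<epsilon> * q ^ (k - 1)"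
    using assms(1,2) by (simp add: field_simps)
  have "real d * real k * 1 \<le> real d * real k * real n" using assms(2) by (intro mult_left_mono) auto
  with le have le1: "real d * real k \<le> \<nu> * \<epsilon> * q ^ (k - 1)" by (simp add: mult.assoc)
  have "k \<noteq> 1"
  proof
    assume "k = 1"
    with le1 ve have "real d < 1" by simp
    with False show False by simp
  qed
  with assms(1) have k2: "real k \<ge> 2" by simp
  have "real d * real (Suc k) < real d * (real k * 2)" using False k2 by (intro mult_strict_left_mono) auto
  also have "\<dots> \<le> real d * (real k * q)" using assms(3) by (intro mult_left_mono) auto
  also have "\<dots> = (real d * real k) * q" by simp
  also have "\<dots> \<le> \<nu> * \<epsilon> * q ^ (k - 1) * q" using le1 assms(3) by (intro mult_right_mono) auto
  also have "\<dots> = \<nu> * \<epsilon> * q ^ k" using assms(1) by (cases k) auto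
  finally show ?thesis .
qed

theorem theorem3p1:
  fixes E :: "('a::{field,finite} fls ^ 'n) set" and k :: nat and \<epsilon> \<nu> :: real
  assumes "k > 0"
    and "\<epsilon> \<in> {0<..<1}" and "\<nu> \<in> {0<..<1}"
    and "E \<subseteq> power_series_vecs"
    and "kakeya_set \<epsilon> \<nu> E"
  shows "\<not> (\<exists>\<B> \<subseteq> {sup_cball c (real CARD('a) powi (- int k)) | c. True}.
              finite \<B> \<and> E \<subseteq> \<Union>\<B> \<and>
              card \<B> < (nat \<lfloor>\<nu> * \<epsilon> / (real k * real CARD('n)) * real CARD('a) ^ (k - 1)\<rfloor> + CARD('n))
                         choose CARD('n))"
proof
  let ?q = "CARD('a)" and ?n = "CARD('n)"
  define d where "d = nat \<lfloor>\<nu> * \<epsilon> / (real k * real ?n) * real ?q ^ (k - 1)\<rfloor>"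
  assume "\<exists>\<B> \<subseteq> {sup_cball c (real CARD('a) powi (- int k)) | c. True}.
      finite \<B> \<and> E \<subseteq> \<Union>\<B> \<and>
      card \<B> < (nat \<lfloor>\<nu> * \<epsilon> / (real k * real CARD('n)) * real CARD('a) ^ (k - 1)\<rfloor> + CARD('n)) choose CARD('n)"
  then obtain \<B> where \<B>: "\<B> \<subseteq> {sup_cball c (real ?q powi (- int k)) | c. True}" "finite \<B>" "E \<subseteq> \<Union>\<B>"
      "card \<B> < (d + ?n) choose ?n"
    unfolding d_def by blast
  obtain \<Omega> where \<Omega>: "\<Omega> \<in> sets (haar (power_series_vecs :: ('a fls ^ 'n) set))" "\<Omega> \<subseteq> primitive_vecs"
      "measure (haar power_series_vecs) \<Omega> \<ge> \<nu>"
      "\<And>w. w \<in> \<Omega> \<Longrightarrow> \<exists>b. \<exists>J \<in> sets (haar (power_series :: 'a fls set)).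
           measure (haar power_series) J \<ge> \<epsilon> \<and> {b + x *s w | x. x \<in> J} \<subseteq> E"
    using assms(5) unfolding kakeya_set_def by blast
  have q2: "?q \<ge> 2" by (rule card_field_ge_2)
  obtain s :: "'a fps" where s: "fps_nth s 0 = 0" "(carlitz s ^^ k) fps_X = 0"
      "(carlitz s ^^ (k - 1)) fps_X \<noteq> 0"
    using carlitz_torsion_exists[OF assms(1)] .
  define \<phi> where "\<phi> = (\<lambda>a. carlitz_act s k a fps_X)"
  \<comment> \<open>On the integral points of \<open>E\<close>, \<open>fls_regpart\<close> merely
    reads a Laurent series as a power series.\<close>
  define \<Phi> where "\<Phi> x = (\<lambda>j. \<phi> (fls_regpart (x $ j)))" for x :: "'a fls ^ 'n"

  \<comment> \<open>Points of one ball agree modulo t^k, and \<open>\<phi>\<close> sees only the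
    first \<open>k\<close> coefficients, so \<open>\<Phi>\<close> takes at most one value per
    ball.\<close>
  have "\<Phi> x = \<Phi> y" if B: "B \<in> \<B>" "x \<in> B" "y \<in> B" for B x y
  proof -
    obtain c where c: "B = sup_cball c (real ?q powi (- int k))" using \<B>(1) B(1) by blast
    have "fls_nth (x $ j) (int i) = fls_nth (y $ j) (int i)" if "i < k" for i j
      using sup_cball_digits[OF _ that, of x c j] sup_cball_digits[OF _ that, of y c j] B c by simp
    then show ?thesis unfolding \<Phi>_def \<phi>_def by (intro ext carlitz_act_cong) simp
  qed
  then have fin\<Phi>: "finite (\<Phi> ` E)" and "card (\<Phi> ` E) \<le> card \<B>"
    using card_image_le_card_cover[OF \<B>(2,3), of \<Phi>] by blast+

  define S where "S = {\<alpha> :: 'n \<Rightarrow> nat. (\<Sum>j\<in>UNIV. \<alpha> j) \<le> d}"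
  have finS: "finite S" unfolding S_def by (rule finite_exponents)
  have "card (\<Phi> ` E) < card S"
    using \<open>card (\<Phi> ` E) \<le> card \<B>\<close> \<B>(4) card_exponents_ge[of d, where 'n = 'n] unfolding S_def by linarith
  \<comment> \<open>There is one equation per value of \<open>\<Phi>\<close> on \<open>E\<close> and
    one unknown per monomial of degree at most \<open>d\<close>.\<close>
  then obtain c0 :: "('n \<Rightarrow> nat) \<Rightarrow> 'a fps" where c0: "\<exists>\<alpha>\<in>S. c0 \<alpha> \<noteq> 0"
      "\<And>t. t \<in> \<Phi> ` E \<Longrightarrow> (\<Sum>\<alpha>\<in>S. c0 \<alpha> * (\<Prod>j\<in>UNIV. t j ^ \<alpha> j)) = 0"
    using homogeneous_system_nontrivial[OF fin\<Phi> finS, of "\<lambda>t \<alpha>. \<Prod>j\<in>UNIV. t j ^ \<alpha> j"] by blast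
  obtain \<alpha>0 where \<alpha>0: "\<alpha>0 \<in> S" "c0 \<alpha>0 \<noteq> 0" using c0(1) by blast
  \<comment> \<open>Dividing out the common power of X makes the reduction modulo X nonzero and
    keeps the zeros.\<close>
  obtain e where e: "\<forall>\<alpha>\<in>S. c0 \<alpha> = fps_X ^ e * fps_shift e (c0 \<alpha>)"
      "\<exists>\<alpha>\<in>S. fps_nth (c0 \<alpha>) e \<noteq> 0"
    using fps_family_primitive[of S \<alpha>0 c0, OF finS \<alpha>0] .
  define c where "c \<alpha> = fps_shift e (c0 \<alpha>)" for \<alpha>
  have van: "(\<Sum>\<alpha>\<in>S. c \<alpha> * (\<Prod>j\<in>UNIV. t j ^ \<alpha> j)) = 0" if "t \<in> \<Phi> ` E" for t
  proof -
    have "fps_X ^ e * (\<Sum>\<alpha>\<in>S. c \<alpha> * (\<Prod>j\<in>UNIV. t j ^ \<alpha> j)) = (\<Sum>\<alpha>\<in>S. c0 \<alpha> * (\<Prod>j\<in>UNIV. t j ^ \<alpha> j))"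
      unfolding sum_distrib_left using e(1)
      by (intro sum.cong refl) (metis c_def mult.assoc)
    then show ?thesis using c0(2)[OF that] by simp
  qed

  define S0 where "S0 = {\<alpha>\<in>S. fps_nth (c \<alpha>) 0 \<noteq> 0}"
  have S0: "finite S0" "S0 \<noteq> {}" using finS e(2) by (auto simp: S0_def c_def)
  let ?gaps = "frobenius_gaps ?q k"
  define L where "L = {cs :: 'a list. length cs = k}"
  \<comment> \<open>A lower bound for the number of residue classes met by each \<open>J\<close>. As
    \<open>M\<close> is at most q^k, the sum k q^k + M is at most (k + 1) q^k, which gives the
    factor \<open>Suc k\<close> in \<open>upper\<close>.\<close>
  define M where "M = nat \<lceil>\<epsilon> * real ?q ^ k\<rceil>"
  have "\<epsilon> * real ?q ^ k \<le> real ?q ^ k" using assms(2) by simp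
  then have M: "M \<le> ?q ^ k" "\<epsilon> * real ?q ^ k \<le> real M"
    unfolding M_def by (simp_all add: ceiling_le_iff nat_le_iff)  linarith
  define F where "F v = (\<Sum>\<alpha>\<in>S0. fps_const (fps_nth (c \<alpha>) 0) * (\<Prod>j\<in>UNIV. digit_series ?gaps (v j) ^ \<alpha> j))"
    for v :: "'n \<Rightarrow> 'a list"
  have upper: "(\<Sum>v\<in>PiE UNIV (\<lambda>_. L). trunc_order M (F v)) \<le> d * Suc k * (?q ^ k) ^ ?n"
  proof -
    have "(\<Sum>v\<in>PiE UNIV (\<lambda>_. {cs :: 'a list. length cs = length ?gaps}). trunc_order M (F v))
        \<le> d * Suc k * (?q ^ length ?gaps) ^ card (UNIV :: 'n set)"
      unfolding F_def
    proof (rule sum_trunc_order_multivariate)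
      show "gap_weight ?q ?gaps + M \<le> Suc k * ?q ^ length ?gaps"
        using gap_weight_frobenius_gaps[of ?q k] M(1) by simp
      show "a > 0" if "a \<in> set ?gaps" for a using frobenius_gaps_pos[OF q2 that] .
      show "inj_on (\<lambda>\<alpha>. restrict \<alpha> UNIV) S0" by (simp add: inj_on_def restrict_def)
    qed (use S0 in \<open>simp_all add: S0_def S_def\<close>)
    then show ?thesis by (simp only: length_frobenius_gaps L_def)
  qed

  define tr where "tr w = (\<lambda>j. fls_digits k (w $ j))" for w :: "'a fls ^ 'n"
  \<comment> \<open>The line in direction \<open>w\<close> carries at least \<open>M\<close>
    distinct zeros \<open>\<phi> x\<close>, so the reduction vanishes to order at least
    \<open>M\<close> and the cap is attained.\<close>
  have full: "trunc_order M (F (tr w)) = M" if w: "w \<in> \<Omega>" for w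
  proof -
    obtain b J where J: "J \<in> sets (haar (power_series :: 'a fls set))"
        "measure (haar power_series) J \<ge> \<epsilon>" "{b + x *s w | x. x \<in> J} \<subseteq> E"
      using \<Omega>(4)[OF w] by blast
    have JA: "J \<subseteq> power_series"
      using J(1) normalized_haar_haar[where 'a = 'a] by (auto simp: normalized_haar_def sets_restrict_space)
    have wA: "w $ j \<in> power_series" for j
      using \<Omega>(2) w by (auto simp: primitive_vecs_def power_series_vecs_def)
    have "J \<noteq> {}" using J(2) assms(2) by auto
    then obtain x0 where x0: "x0 \<in> J" by blast
    have bA: "b $ j \<in> power_series" for j
    proof -
      have "b + x0 *s w \<in> power_series_vecs" using J(3) x0 assms(4) by blast
      then have "b $ j + x0 * w $ j \<in> power_series" by (auto simp: power_series_vecs_def)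
      moreover have "x0 * w $ j \<in> power_series" using x0 JA wA by (auto intro: power_series_mult)
      ultimately show ?thesis using power_series_diff by fastforce
    qed
    have vanJ: "(\<Sum>\<alpha>\<in>S. c \<alpha> * (\<Prod>j\<in>UNIV. \<phi> (fls_regpart (b $ j) + fls_regpart (w $ j) * x) ^ \<alpha> j)) = 0"
      if x: "x \<in> fls_regpart ` J" for x
    proof -
      obtain y where y: "y \<in> J" "x = fls_regpart y" using x by blast
      have "\<Phi> (b + y *s w) = (\<lambda>j. \<phi> (fls_regpart (b $ j) + fls_regpart (w $ j) * x))"
        unfolding \<Phi>_def using y JA wA by (simp add: fls_regpart_mult subsetD mult.commute)
      moreover have "\<Phi> (b + y *s w) \<in> \<Phi> ` E" using y J(3) by blast
      ultimately show ?thesis using van by metis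
    qed
    \<comment> \<open>\<open>\<phi>\<close> depends only on the first \<open>k\<close> digits and
      separates them because X is a primitive torsion point; hence there are as many zeros as
      residue classes of \<open>J\<close>.\<close>
    define \<psi> where "\<psi> cs = \<phi> (Abs_fps (\<lambda>i. cs ! i))" for cs
    have "\<phi> (fls_regpart y) = \<psi> (fls_digits k y)" for y
      unfolding \<phi>_def \<psi>_def by (intro carlitz_act_cong) (simp add: fls_digits_def)
    then have im: "\<phi> ` fls_regpart ` J = \<psi> ` fls_digits k ` J" by (simp add: image_image)
    have finJ: "finite (fls_digits k ` J)"
      by (rule finite_subset[OF _ finite_lists_length[of k]]) auto
    have "inj_on \<psi> (fls_digits k ` J)"
    proof (rule inj_onI)
      fix cs cs' assume cs: "cs \<in> fls_digits k ` J" "cs' \<in> fls_digits k ` J" and eq: "\<psi> cs = \<psi> cs'"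
      have "cs ! i = cs' ! i" if "i < k" for i
        using carlitz_act_inj[OF s(2,3) eq[unfolded \<psi>_def \<phi>_def] that] by simp
      then show "cs = cs'" using cs by (intro nth_equalityI) auto
    qed
    then have card: "card (\<phi> ` fls_regpart ` J) = card (fls_digits k ` J)" unfolding im by (rule card_image)
    have "\<epsilon> * real ?q ^ k \<le> measure (haar power_series) J * real ?q ^ k"
      using J(2) by (intro mult_right_mono) auto
    also have "\<dots> \<le> real (card (fls_digits k ` J))" by (rule haar_power_series_le[OF J(1)])
    finally have "M \<le> card (\<phi> ` fls_regpart ` J)" unfolding M_def card by (simp add: nat_le_iff ceiling_le_iff)
    then have "fps_X ^ M dvd (fps_X ^ card (\<phi> ` fls_regpart ` J) :: 'a fps)" by (rule le_imp_power_dvd)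
    also have "\<dots> dvd (\<Sum>\<alpha>\<in>S. fps_const (fps_nth (c \<alpha>) 0) *
        (\<Prod>j\<in>UNIV. digit_series ?gaps (map (fps_nth (fls_regpart (w $ j))) [0..<k]) ^ \<alpha> j))"
      unfolding \<phi>_def
      by (rule line_vanishing[OF s(1,2) _ vanJ[unfolded \<phi>_def]])
         (use im finJ in \<open>auto simp: \<phi>_def\<close>)
    also have "\<dots> = F (tr w)"
      unfolding F_def S0_def using finS
      by (intro sum.mono_neutral_cong_right) (auto simp: tr_def map_nth_fls_regpart)
    finally show ?thesis by (rule trunc_order_eqI)
  qed

  \<comment> \<open>Double counting: at least \<nu> q^(kn) residues of good directions contribute
    \<open>M\<close> each, while all directions together contribute at most d (k + 1) q^(kn). This
    contradicts \<open>kakeya_arith\<close>.\<close>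
  have "\<nu> * \<epsilon> * real ?q ^ k * (real ?q ^ k) ^ ?n \<le> (\<nu> * (real ?q ^ k) ^ ?n) * (\<epsilon> * real ?q ^ k)" by simp
  also have "\<dots> \<le> real (card (tr ` \<Omega>)) * real M"
  proof (rule mult_mono)
    have "\<nu> * (real ?q ^ k) ^ ?n \<le> measure (haar power_series_vecs) \<Omega> * (real ?q ^ k) ^ ?n"
      using \<Omega>(3) by (intro mult_right_mono) auto
    also have "\<dots> \<le> real (card (tr ` \<Omega>))"
      unfolding tr_def by (rule haar_power_series_vecs_le[OF \<Omega>(1)])
    finally show "\<nu> * (real ?q ^ k) ^ ?n \<le> real (card (tr ` \<Omega>))" .
  qed (use M assms(2) in auto)
  also have "\<dots> = real (\<Sum>v\<in>tr ` \<Omega>. trunc_order M (F v))"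
    using full by (subst sum.cong[OF refl, of _ _ "\<lambda>_. M"]) auto
  also have "\<dots> \<le> real (\<Sum>v\<in>PiE UNIV (\<lambda>_. L). trunc_order M (F v))"
    unfolding of_nat_le_iff
    by (intro sum_mono2 finite_PiE) (auto simp: L_def tr_def)
  also have "\<dots> \<le> real (d * Suc k * (?q ^ k) ^ ?n)" using upper by (simp only: of_nat_le_iff)
  also have "\<dots> = (real d * real (Suc k)) * (real ?q ^ k) ^ ?n"
    by (simp only: of_nat_mult of_nat_power)
  finally have "\<nu> * \<epsilon> * real ?q ^ k \<le> real d * real (Suc k)"
    by (simp only: mult_le_cancel_right) simp
  moreover have "real d * real (Suc k) < \<nu> * \<epsilon> * real ?q ^ k"
    by (rule kakeya_arith[OF assms(1) _ _ assms(2,3) d_def]) (use q2 in auto)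
  ultimately show False by simp
qed

end
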